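(* If $\mathfrak{X}$ denotes an $N$-parameter additive Lévy process in $\mathbb{R}^d$, then for every fixed $\beta\in(0,d)$, the probability that $\mathcal{C}_\beta(\mathfrak{X}(\mathbb{R}^N_+))$ is strictly positive is either zero or one.
   Context: An $N$-parameter additive Lévy process in $\mathbb{R}^d$ is the random field $\mathfrak{X}(\boldsymbol t):=X_1(t_1)+\cdots+X_N(t_N)$, $\boldsymbol t\in\mathbb{R}^N_+$ ($\mathbb{R}_+=[0,\infty)$), where $X_1,\ldots,X_N$ are independent Lévy processes on $\mathbb{R}^d$ (cadlag, stationary independent increments, $X_j(0)=0$). For $s>0$ and $A\subseteq\mathbb{R}^d$, the $s$-dimensional Bessel–Riesz capacity is $\mathcal{C}_s(A):=\left[\inf_{\mu\in\mathcal{P}_c(A)}\iint\frac{\mu(dx)\,\mu(dy)}{\|x-y\|^s}\right]^{-1}$, where $\mathcal{P}_c(A)$ is the collection of all compact-support Borel probability measures on $A$, $\inf\varnothing:=\infty$ and $1/\infty:=0$. *)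

theory Defs
  imports "HOL-Probability.Probability"
begin

section \<open>Levy processes and additive Levy processes\<close>

text \<open>Time is the half-line \<open>{0..}\<close>; values of a path at negative arguments play no role.
  The space \<open>R^d\<close> is an arbitrary Euclidean space, with \<open>d\<close> its dimension.\<close>

definition cadlag :: "(real \<Rightarrow> 'a::topological_space) \<Rightarrow> bool" where
  "cadlag f \<longleftrightarrow>
     (\<forall>t\<ge>0. (f \<longlongrightarrow> f t) (at_right t)) \<and>
     (\<forall>t>0. \<exists>l. (f \<longlongrightarrow> l) (at_left t))"

definition independent_increments ::
  "'w measure \<Rightarrow> (real \<Rightarrow> 'w \<Rightarrow> 'a::euclidean_space) \<Rightarrow> bool" where
  "independent_increments M X \<longleftrightarrow>
     (\<forall>(n::nat) (t::nat \<Rightarrow> real). 0 \<le> t 0 \<and> mono t \<longrightarrow>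
        prob_space.indep_vars M (\<lambda>_. borel) (\<lambda>i \<omega>. X (t (Suc i)) \<omega> - X (t i) \<omega>) {..<n})"

definition stationary_increments ::
  "'w measure \<Rightarrow> (real \<Rightarrow> 'w \<Rightarrow> 'a::euclidean_space) \<Rightarrow> bool" where
  "stationary_increments M X \<longleftrightarrow>
     (\<forall>s\<ge>0. \<forall>t\<ge>0. distr M borel (\<lambda>\<omega>. X (s + t) \<omega> - X s \<omega>)
                     = distr M borel (\<lambda>\<omega>. X t \<omega> - X 0 \<omega>))"

definition levy_process ::
  "'w measure \<Rightarrow> (real \<Rightarrow> 'w \<Rightarrow> 'a::euclidean_space) \<Rightarrow> bool" where
  "levy_process M X \<longleftrightarrow>
     prob_space M \<and>
     (\<forall>t\<ge>0. X t \<in> borel_measurable M) \<and>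
     (\<forall>\<omega>\<in>space M. X 0 \<omega> = 0) \<and>
     (\<forall>\<omega>\<in>space M. cadlag (\<lambda>t. X t \<omega>)) \<and>
     independent_increments M X \<and>
     stationary_increments M X"

text \<open>Independence of the processes \<open>X 1, \<dots>, X N\<close> is independence of the sigma-algebras
  generated by the whole processes: each process is regarded as one random variable with values
  in the product space \<open>R^d\<close> to the power \<open>{0..}\<close>.\<close>

definition independent_processes ::
  "'w measure \<Rightarrow> nat \<Rightarrow> (nat \<Rightarrow> real \<Rightarrow> 'w \<Rightarrow> 'a::euclidean_space) \<Rightarrow> bool" where
  "independent_processes M N X \<longleftrightarrow>
     prob_space.indep_vars M (\<lambda>_. PiM {0::real..} (\<lambda>_. borel))
       (\<lambda>j \<omega>. \<lambda>t\<in>{0..}. X j t \<omega>) {1..N}"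

text \<open>The data \<open>X 1, \<dots>, X N\<close> of an \<open>N\<close>-parameter additive Levy process; the random field
  itself is \<open>additive_field N X\<close>.\<close>

definition additive_levy_process ::
  "'w measure \<Rightarrow> nat \<Rightarrow> (nat \<Rightarrow> real \<Rightarrow> 'w \<Rightarrow> 'a::euclidean_space) \<Rightarrow> bool" where
  "additive_levy_process M N X \<longleftrightarrow>
     1 \<le> N \<and> (\<forall>j\<in>{1..N}. levy_process M (X j)) \<and> independent_processes M N X"

definition additive_field ::
  "nat \<Rightarrow> (nat \<Rightarrow> real \<Rightarrow> 'w \<Rightarrow> 'a::euclidean_space) \<Rightarrow> (nat \<Rightarrow> real) \<Rightarrow> 'w \<Rightarrow> 'a" where
  "additive_field N X t \<omega> = (\<Sum>j\<in>{1..N}. X j (t j) \<omega>)"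

definition time_orthant :: "nat \<Rightarrow> (nat \<Rightarrow> real) set" where
  "time_orthant N = (\<Pi>\<^sub>E j\<in>{1..N}. {0..})"

section \<open>Bessel-Riesz capacity\<close>

definition measure_support :: "'a::topological_space measure \<Rightarrow> 'a set" where
  "measure_support \<mu> = {x. \<forall>U. open U \<and> x \<in> U \<longrightarrow> 0 < emeasure \<mu> U}"

definition compact_prob_measures :: "'a::euclidean_space set \<Rightarrow> 'a measure set" where
  "compact_prob_measures A =
     {\<mu>. sets \<mu> = sets borel \<and> prob_space \<mu> \<and>
         compact (measure_support \<mu>) \<and> measure_support \<mu> \<subseteq> A}"

text \<open>The reciprocal is taken in \<^typ>\<open>ennreal\<close>, so for \<open>s > 0\<close> the kernel is infinite on the
  diagonal, as it should be; in the reals it would be \<open>0\<close> there.\<close>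

definition riesz_energy :: "real \<Rightarrow> 'a::euclidean_space measure \<Rightarrow> ennreal" where
  "riesz_energy s \<mu> = (\<integral>\<^sup>+x. \<integral>\<^sup>+y. 1 / ennreal (norm (x - y) powr s) \<partial>\<mu> \<partial>\<mu>)"

text \<open>In \<^typ>\<open>ennreal\<close> the infimum of the empty set and \<open>inverse 0\<close> are both infinite, and the
  inverse of infinity is \<open>0\<close>.\<close>

definition riesz_capacity :: "real \<Rightarrow> 'a::euclidean_space set \<Rightarrow> ennreal" where
  "riesz_capacity s A = inverse (INF \<mu>\<in>compact_prob_measures A. riesz_energy s \<mu>)"

end

theory Submission
  imports Defs
begin

text \<open>Capacity is positive on the whole range iff it is positive on the image of some cube
  \<open>[0, n]^N\<close>. Positivity on the image of a cube is equivalent to a condition on finitely many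
  points of the image at a time: for some \<open>C\<close> and all \<open>L\<close> there are \<open>L\<close> points whose kernels sum to
  at most \<open>C L^2\<close> over pairs. By right continuity the points may be taken at dyadic times, so that the
  event is obtained from events about finitely many increments by monotone limits; this gives
  measurability.

  One direction is a greedy choice of points. For the other one, the pairs (time, value) are lifted
  to \<open>[0, 1]\<close> by a space-filling curve, where Helly's and Skorohod's theorems produce a limit
  measure of finite energy on the closure of the image. The closure only adds left limits, which
  can be removed since the paths have countably many jumps and the energy is translation invariant.

  The events for the diagonal blocks \<open>[i n, (i + 1) n]^N\<close> are independent and equally likely,
  because they are determined by disjoint families of increments, and each of them implies the event
  of the theorem. So if one has positive probability, the event of the theorem has probability one.\<close>

section \<open>A space-filling curve\<close>

text \<open>There are of order \<open>L^2\<close> pairs among \<open>L\<close> points, so the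
  finite-point condition bounds the energy of their uniform distribution off the diagonal. On the
  diagonal the kernel is infinite, so these distributions have infinite energy themselves; hence the
  truncation before the weak limit is taken. Two properties of the kernel carry the argument. It is
  continuous with values in [0, infinity], even on the diagonal, so the condition survives the
  passage to dense subsets. And it depends on differences only, which is used twice: a limit measure
  concentrated on left limits is moved back into the range by one constant shift, and the value of
  the field at the start of a block, which depends on the past, drops out of the event of that
  block. Passing to dyadic points costs something in the constant \<open>C\<close>, and no value of
  \<open>C\<close> is distinguished; so the event has to be a union over all
  \<open>C\<close>.\<close>

text \<open>\<open>schoenberg_bump (3 ^ k * t)\<close> reads off the \<open>k\<close>-th ternary digit of a point \<open>t\<close> of the Cantor
  set; the coordinates of the Schoenberg curve use disjoint sets of digits.\<close>

definition schoenberg_bump :: "real \<Rightarrow> real" where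
  "schoenberg_bump t = max 0 (min 1 (1 / 2 - cos (pi * t)))"

lemma schoenberg_bump_bounds: "0 \<le> schoenberg_bump t" "schoenberg_bump t \<le> 1"
  by (auto simp: schoenberg_bump_def)

lemma continuous_on_schoenberg_bump [continuous_intros]:
  fixes f :: "'a::t2_space \<Rightarrow> real"
  shows "continuous_on A f \<Longrightarrow> continuous_on A (\<lambda>x. schoenberg_bump (f x))"
  unfolding schoenberg_bump_def by (intro continuous_intros)

lemma schoenberg_bump_periodic: "schoenberg_bump (2 * real n + t) = schoenberg_bump t"
proof -
  have "pi * (2 * real n + t) = pi * t + real n * (2 * pi)"
    by (simp add: algebra_simps)
  then have "cos (pi * (2 * real n + t)) = cos (pi * t)"
    using sin_2npi[of n] cos_2npi[of n] by (simp only: cos_add) (simp add: mult_ac)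
  then show ?thesis
    by (simp add: schoenberg_bump_def)
qed

lemma schoenberg_bump_low:
  assumes "0 \<le> t" "t \<le> 1 / 3"
  shows "schoenberg_bump t = 0"
proof -
  have "cos (pi / 3) \<le> cos (pi * t)"
    using assms by (intro cos_monotone_0_pi_le) (auto simp: field_simps)
  then show ?thesis
    by (simp add: schoenberg_bump_def cos_60)
qed

lemma schoenberg_bump_high:
  assumes "2 / 3 \<le> t" "t \<le> 1"
  shows "schoenberg_bump t = 1"
proof -
  have "cos (pi * t) \<le> cos (pi - pi / 3)"
    using assms by (intro cos_monotone_0_pi_le) (auto simp: field_simps)
  then show ?thesis
    by (simp only: schoenberg_bump_def cos_diff cos_60 cos_pi sin_pi)
qed

definition cantor_point :: "(nat \<Rightarrow> bool) \<Rightarrow> real" where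
  "cantor_point b = (\<Sum>n. 2 * of_bool (b n) * (1 / 3) ^ Suc n)"

lemma summable_cantor_point: "summable (\<lambda>n. 2 * of_bool (b n) * (1 / 3 :: real) ^ Suc n)"
proof (rule summable_comparison_test')
  show "summable (\<lambda>n. 2 * (1 / 3 :: real) ^ Suc n)"
    by (intro summable_mult summable_ignore_initial_segment[where k = 1, simplified] summable_geometric) simp
qed auto

lemma cantor_point_bounds: "0 \<le> cantor_point b" "cantor_point b \<le> 1"
proof -
  show "0 \<le> cantor_point b"
    unfolding cantor_point_def by (intro suminf_nonneg summable_cantor_point) auto
  have "(\<lambda>n. 2 / 3 * (1 / 3 :: real) ^ n) sums (2 / 3 * (1 / (1 - 1 / 3)))"
    by (intro sums_mult geometric_sums) simp
  then have *: "(\<lambda>n. 2 * (1 / 3 :: real) ^ Suc n) sums 1"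
    by simp
  have "cantor_point b \<le> (\<Sum>n. 2 * (1 / 3 :: real) ^ Suc n)"
    unfolding cantor_point_def
    by (intro suminf_le summable_cantor_point sums_summable[OF *]) auto
  then show "cantor_point b \<le> 1"
    using sums_unique[OF *] by simp
qed

lemma cantor_point_shift: "3 * cantor_point b = 2 * of_bool (b 0) + cantor_point (\<lambda>n. b (Suc n))"
proof -
  have "cantor_point b = (\<Sum>n. 2 * of_bool (b (Suc n)) * (1 / 3) ^ Suc (Suc n)) + 2 * of_bool (b 0) * (1 / 3) ^ Suc 0"
    unfolding cantor_point_def by (subst suminf_split_head[OF summable_cantor_point]) simp
  also have "(\<Sum>n. 2 * of_bool (b (Suc n)) * (1 / 3 :: real) ^ Suc (Suc n)) = (1 / 3) * cantor_point (\<lambda>n. b (Suc n))"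
    unfolding cantor_point_def
    by (subst suminf_mult[OF summable_cantor_point, symmetric]) (simp add: mult_ac)
  finally show ?thesis
    by simp
qed

text \<open>Multiplication by \<open>3 ^ k\<close> shifts the ternary digits by \<open>k\<close>
  places. All digits are 0 or 2, so the integer part split off is even and disappears by
  periodicity; the rest starts with the digit \<open>2 * b k\<close> and lies in [0, 1/3] or
  [2/3, 1], where the bump is constant.\<close>

lemma schoenberg_bump_cantor_point: "schoenberg_bump (3 ^ k * cantor_point b) = of_bool (b k)"
proof (induction k arbitrary: b)
  case 0
  have "3 * cantor_point b = 2 * of_bool (b 0) + cantor_point (\<lambda>n. b (Suc n))"
    by (rule cantor_point_shift)
  with cantor_point_bounds[of "\<lambda>n. b (Suc n)"] show ?case
    by (cases "b 0") (auto intro!: schoenberg_bump_low schoenberg_bump_high)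
next
  case (Suc k)
  have "3 ^ Suc k * cantor_point b = 3 ^ k * (3 * cantor_point b)"
    by simp
  also have "\<dots> = 2 * real (3 ^ k * of_bool (b 0)) + 3 ^ k * cantor_point (\<lambda>n. b (Suc n))"
    unfolding cantor_point_shift by (simp add: algebra_simps)
  finally show ?case
    using Suc.IH[of "\<lambda>n. b (Suc n)"] by (simp only: schoenberg_bump_periodic)
qed

text \<open>Doubling the argument of a floor doubles its value and adds the next binary digit. So
  the partial sums are the dyadic truncations of \<open>u\<close>, within \<open>(1 / 2) ^ k\<close>
  of it; the recursion starts at 0 because \<open>u\<close> has integer part 0.\<close>

lemma binary_expansion:
  fixes u :: real
  assumes "0 \<le> u" "u < 1"
  shows "(\<lambda>l. of_bool (odd \<lfloor>2 ^ Suc l * u\<rfloor>) * (1 / 2) ^ Suc l) sums u"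
proof -
  have floor: "\<lfloor>2 * x\<rfloor> = 2 * \<lfloor>x\<rfloor> + of_bool (odd \<lfloor>2 * x\<rfloor>)" for x :: real
  proof -
    have "\<lfloor>2 * x\<rfloor> = 2 * \<lfloor>x\<rfloor> \<or> \<lfloor>2 * x\<rfloor> = 2 * \<lfloor>x\<rfloor> + 1"
      by linarith
    then show ?thesis
      by auto
  qed
  have partial: "(\<Sum>l<k. of_bool (odd \<lfloor>2 ^ Suc l * u\<rfloor>) * (1 / 2) ^ Suc l) = real_of_int \<lfloor>2 ^ k * u\<rfloor> / 2 ^ k" for k
  proof (induction k)
    case 0
    have "\<lfloor>u\<rfloor> = 0" using assms by linarith
    then show ?case by simp
  next
    case (Suc k)
    have "real_of_int \<lfloor>2 ^ Suc k * u\<rfloor> = 2 * of_int \<lfloor>2 ^ k * u\<rfloor> + of_bool (odd \<lfloor>2 ^ Suc k * u\<rfloor>)"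
      using arg_cong[OF floor[of "2 ^ k * u"], of real_of_int] by (simp add: mult.assoc)
    then show ?case
      using Suc by (simp add: field_simps)
  qed
  have "(\<lambda>k. of_int \<lfloor>2 ^ k * u\<rfloor> / 2 ^ k) \<longlonglongrightarrow> u"
  proof (rule LIM_zero_cancel, rule Lim_null_comparison)
    show "(\<lambda>k. (1 / 2 :: real) ^ k) \<longlonglongrightarrow> 0"
      by (intro LIMSEQ_power_zero) simp
    have "norm (of_int \<lfloor>2 ^ k * u\<rfloor> / 2 ^ k - u) \<le> (1 / 2) ^ k" for k
    proof -
      have "of_int \<lfloor>2 ^ k * u\<rfloor> / 2 ^ k - u = (of_int \<lfloor>2 ^ k * u\<rfloor> - 2 ^ k * u) / 2 ^ k"
        by (simp add: field_simps)
      moreover have "\<bar>of_int \<lfloor>2 ^ k * u\<rfloor> - 2 ^ k * u\<bar> \<le> 1"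
        by linarith
      ultimately show ?thesis
        by (simp add: abs_divide divide_right_mono power_one_over)
    qed
    then show "\<forall>\<^sub>F k in sequentially. norm (of_int \<lfloor>2 ^ k * u\<rfloor> / 2 ^ k - u) \<le> (1 / 2) ^ k"
      by simp
  qed
  then show ?thesis
    unfolding sums_def partial .
qed

definition schoenberg_coordinate :: "nat \<Rightarrow> real \<Rightarrow> real" where
  "schoenberg_coordinate c t = (\<Sum>l. schoenberg_bump (3 ^ prod_encode (c, l) * t) * (1 / 2) ^ Suc l)"

lemma continuous_on_schoenberg_coordinate: "continuous_on UNIV (schoenberg_coordinate c)"
  unfolding schoenberg_coordinate_def
proof (rule uniform_limit_theorem[OF _ Weierstrass_m_test])
  show "\<forall>\<^sub>F n in sequentially. continuous_on UNIV (\<lambda>t. \<Sum>l<n. schoenberg_bump (3 ^ prod_encode (c, l) * t) * (1 / 2) ^ Suc l)"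
    by (intro always_eventually allI continuous_intros)
  show "summable (\<lambda>l. (1 / 2 :: real) ^ Suc l)"
    by (intro summable_ignore_initial_segment[where k = 1, simplified] summable_geometric) simp
qed (auto simp: schoenberg_bump_bounds intro!: mult_left_le_one_le)

text \<open>One Cantor point stores the binary digits of all \<open>u c\<close> simultaneously:
  ternary place \<open>prod_encode (c, l)\<close> holds digit \<open>l\<close> of
  \<open>u c\<close>.\<close>

lemma schoenberg_coordinate_surj:
  assumes "\<And>c. 0 \<le> u c" "\<And>c. u c < 1"
  shows "\<exists>t\<in>{0..1}. \<forall>c. schoenberg_coordinate c t = u c"
proof -
  define b where "b n = (case prod_decode n of (c, l) \<Rightarrow> odd \<lfloor>2 ^ Suc l * u c\<rfloor>)" for n
  have "schoenberg_coordinate c (cantor_point b) = u c" for c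
    unfolding schoenberg_coordinate_def schoenberg_bump_cantor_point
    using sums_unique[OF binary_expansion[OF assms(1)[of c] assms(2)]] by (simp add: b_def)
  then show ?thesis
    using cantor_point_bounds[of b] by (intro bexI[of _ "cantor_point b"]) auto
qed

text \<open>The index \<open>j\<close> and the basis vector are coded together into one coordinate
  number, so a single parameter controls a whole sequence of vectors. Later \<open>G s j\<close> is
  a pair (time, value) for the \<open>j\<close>-th path. The strict bound on the norms keeps every
  rescaled coordinate below 1, as the binary expansion requires.\<close>

lemma space_filling_curve:
  fixes R :: real
  assumes "0 < R"
  obtains G :: "real \<Rightarrow> nat \<Rightarrow> 'b::euclidean_space"
  where "\<And>j. continuous_on UNIV (\<lambda>s. G s j)"
    and "\<And>z. (\<And>j. norm (z j) < R) \<Longrightarrow> \<exists>s\<in>{0..1}. \<forall>j. G s j = z j"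
proof -
  define idx where "idx = to_nat_on (Basis :: 'b set)"
  define G where "G s j = (\<Sum>b\<in>Basis. (R * (2 * schoenberg_coordinate (prod_encode (j, idx b)) s - 1)) *\<^sub>R b :: 'b)" for s j
  have "continuous_on UNIV (\<lambda>s. G s j)" for j
    unfolding G_def by (intro continuous_intros continuous_on_schoenberg_coordinate)
  moreover have "\<exists>s\<in>{0..1}. \<forall>j. G s j = z j" if z: "\<And>j. norm (z j) < R" for z
  proof -
    define e where "e n = from_nat_into (Basis :: 'b set) n" for n
    define u where "u c = (case prod_decode c of (j, n) \<Rightarrow> (z j \<bullet> e n / R + 1) / 2)" for c
    have e: "e n \<in> Basis" for n
      unfolding e_def by (intro from_nat_into) auto
    have "\<bar>z j \<bullet> e n\<bar> < R" for j n
      using Basis_le_norm[OF e[of n], of "z j"] z[of j] by linarith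
    then have "\<bar>z j \<bullet> e n / R\<bar> < 1" for n j
      using assms by (simp add: abs_divide)
    then have bound: "0 \<le> (z j \<bullet> e n / R + 1) / 2 \<and> (z j \<bullet> e n / R + 1) / 2 < 1" for j n
    proof -
      have "0 \<le> (y + 1) / 2 \<and> (y + 1) / 2 < 1" if "\<bar>y\<bar> < 1" for y :: real
        using that by auto
      then show ?thesis
        using \<open>\<And>n j. \<bar>z j \<bullet> e n / R\<bar> < 1\<close> by blast
    qed
    have "\<And>c. 0 \<le> u c" "\<And>c. u c < 1"
      using bound by (auto simp: u_def split: prod.split)
    then have "\<exists>s\<in>{0..1}. \<forall>c. schoenberg_coordinate c s = u c"
      by (rule schoenberg_coordinate_surj)
    then obtain s where
      s: "s \<in> {0..1}" "\<And>c. schoenberg_coordinate c s = u c"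
      by blast
    have "G s j = (\<Sum>b\<in>Basis. (z j \<bullet> b) *\<^sub>R b)" for j
      unfolding G_def s using assms
      by (intro sum.cong refl) (simp add: u_def e_def idx_def countable_finite field_simps)
    then have "\<forall>j. G s j = z j"
      by (simp add: euclidean_representation)
    then show ?thesis
      using s(1) by (rule bexI)
  qed
  ultimately show thesis
    by (rule that)
qed

section \<open>Riesz energy and finite point sets\<close>

definition riesz_kernel :: "real \<Rightarrow> 'a::euclidean_space \<Rightarrow> 'a \<Rightarrow> ennreal" where
  "riesz_kernel s x y = 1 / ennreal (norm (x - y) powr s)"

lemma riesz_kernel_commute: "riesz_kernel s x y = riesz_kernel s y x"
  by (simp add: riesz_kernel_def norm_minus_commute)

lemma riesz_kernel_translate [simp]: "riesz_kernel s (x + c) (y + c) = riesz_kernel s x y"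
  by (simp add: riesz_kernel_def)

text \<open>The diagonal is no exception: for \<open>0 < s\<close> the power is continuous at 0, and
  inversion is continuous on all of \<open>ennreal\<close>. Both the passage to dense sets and the
  use of Fatou's lemma rest on this.\<close>

lemma tendsto_riesz_kernel:
  assumes "0 < s" "(f \<longlongrightarrow> x) F" "(g \<longlongrightarrow> y) F"
  shows "((\<lambda>z. riesz_kernel s (f z) (g z)) \<longlongrightarrow> riesz_kernel s x y) F"
proof -
  have "((\<lambda>z. norm (f z - g z) powr s) \<longlongrightarrow> norm (x - y) powr s) F"
    using assms by (intro tendsto_powr' tendsto_intros) auto
  then have "((\<lambda>z. ennreal (norm (f z - g z) powr s)) \<longlongrightarrow> ennreal (norm (x - y) powr s)) F"
    by (rule tendsto_ennrealI)
  moreover have "isCont (inverse :: ennreal \<Rightarrow> ennreal) z" for z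
    using continuous_on_inverse_ennreal[OF continuous_on_id, of UNIV] by (simp add: continuous_on_eq_continuous_at)
  ultimately show ?thesis
    unfolding riesz_kernel_def divide_ennreal_def by (auto intro: isCont_tendsto_compose)
qed

lemma measurable_riesz_kernel [measurable (raw)]:
  assumes "f \<in> borel_measurable M" "g \<in> borel_measurable M"
  shows "(\<lambda>z. riesz_kernel s (f z) (g z)) \<in> borel_measurable M"
proof -
  have [measurable]: "f \<in> borel_measurable M" "g \<in> borel_measurable M"
    by fact+
  show ?thesis
    unfolding riesz_kernel_def by measurable
qed

lemma riesz_energy_eq: "riesz_energy s \<mu> = (\<integral>\<^sup>+x. \<integral>\<^sup>+y. riesz_kernel s x y \<partial>\<mu> \<partial>\<mu>)"
  by (simp add: riesz_energy_def riesz_kernel_def)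

lemma riesz_capacity_pos_iff:
  "0 < riesz_capacity s A \<longleftrightarrow> (\<exists>\<mu>\<in>compact_prob_measures A. riesz_energy s \<mu> < \<top>)"
  by (simp add: riesz_capacity_def ennreal_inverse_positive less_top INF_less_iff)

lemma closed_measure_support: "closed (measure_support \<mu>)"
proof -
  have "- measure_support \<mu> = \<Union>{U. open U \<and> \<not> 0 < emeasure \<mu> U}"
    by (auto simp: measure_support_def)
  then show ?thesis
    unfolding closed_def by (simp add: open_Union)
qed

text \<open>The null members of a countable basis have a null union, and every point outside that
  union lies in the support.\<close>

lemma AE_measure_support:
  fixes \<mu> :: "'a::second_countable_topology measure"
  assumes "sets \<mu> = sets borel"
  shows "AE x in \<mu>. x \<in> measure_support \<mu>"
proof -
  obtain \<B> :: "'a set set" where \<B>: "countable \<B>" "topological_basis \<B>"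
    using ex_countable_basis by blast
  define \<N> where "\<N> = {U\<in>\<B>. emeasure \<mu> U = 0}"
  have "\<Union>\<N> \<in> null_sets \<mu>"
  proof -
    have "U \<in> null_sets \<mu>" if "U \<in> \<N>" for U
      using that topological_basis_open[OF \<B>(2), of U] assms by (auto simp: \<N>_def null_sets_def)
    then show ?thesis
      using \<B>(1) by (intro null_sets_UN'[of \<N> "\<lambda>U. U", simplified]) (auto simp: \<N>_def)
  qed
  moreover have "x \<in> measure_support \<mu>" if "x \<notin> \<Union>\<N>" for x
    unfolding measure_support_def
  proof safe
    fix U assume "open U" "x \<in> U"
    then obtain V where V: "V \<in> \<B>" "x \<in> V" "V \<subseteq> U"
      using topological_basisE[OF \<B>(2)] by metis
    then have "0 < emeasure \<mu> V"
      using that by (auto simp: \<N>_def zero_less_iff_neq_zero)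
    also have "\<dots> \<le> emeasure \<mu> U"
      using V \<open>open U\<close> assms by (intro emeasure_mono) auto
    finally show "0 < emeasure \<mu> U" .
  qed
  ultimately show ?thesis
    by (auto intro: AE_I' elim!: eventually_mono[rotated])
qed

lemma measure_support_subset:
  assumes "sets \<mu> = sets borel" "closed K" "emeasure \<mu> (- K) = 0"
  shows "measure_support \<mu> \<subseteq> K"
  using assms by (auto simp: measure_support_def closed_def dest!: spec[of _ "- K"])

text \<open>Positivity of the capacity of a compact set is equivalent to this bound for all \<open>L\<close> with one
  constant \<open>C\<close> (finiteness of the transfinite diameter). Unlike the energy of a measure, it only
  involves finitely many points at a time and hence passes to dense subsets.\<close>

definition pairwise_bounded :: "real \<Rightarrow> nat \<Rightarrow> nat \<Rightarrow> 'a::euclidean_space set \<Rightarrow> bool" where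
  "pairwise_bounded s C L A \<longleftrightarrow>
     (\<exists>y. (\<forall>i<L. y i \<in> A) \<and> (\<Sum>j<L. \<Sum>i<j. riesz_kernel s (y i) (y j)) \<le> of_nat (C * L\<^sup>2))"

lemma pairwise_bounded_mono:
  assumes "pairwise_bounded s C L A" "A \<subseteq> B" "C \<le> D"
  shows "pairwise_bounded s D L B"
proof -
  from assms(1) obtain y where
    y: "\<forall>i<L. y i \<in> A" "(\<Sum>j<L. \<Sum>i<j. riesz_kernel s (y i) (y j)) \<le> of_nat (C * L\<^sup>2)"
    unfolding pairwise_bounded_def by blast
  have "(of_nat (C * L\<^sup>2) :: ennreal) \<le> of_nat (D * L\<^sup>2)"
    using \<open>C \<le> D\<close> by (intro of_nat_mono mult_right_mono) auto
  with y \<open>A \<subseteq> B\<close> show ?thesis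
    unfolding pairwise_bounded_def by (intro exI[of _ y]) (auto intro: order_trans)
qed

text \<open>The points are chosen greedily: the average over \<open>S\<close> of the sum of the kernels at the points
  already chosen is at most a constant multiple of their number.\<close>

lemma pairwise_bounded_of_potential_bounded:
  assumes "sets \<mu> = sets borel" "prob_space \<mu>" and S: "S \<in> sets borel" "0 < emeasure \<mu> S"
    and U: "\<And>x. x \<in> S \<Longrightarrow> (\<integral>\<^sup>+y. riesz_kernel s x y \<partial>\<mu>) \<le> of_nat n"
  obtains C where "\<And>L. pairwise_bounded s C L S"
proof -
  interpret prob_space \<mu> by fact
  note [measurable_cong] = assms(1)
  define p where "p = emeasure \<mu> S"
  have p: "p \<noteq> 0" "p \<noteq> \<top>" "p \<le> 1"
    using S emeasure_le_1 by (auto simp: p_def emeasure_eq_measure)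
  \<comment> \<open>\<open>C0\<close> is chosen so that \<open>n\<close> is at most
    \<open>C0 * p\<close>. If every \<open>z\<close> in \<open>S\<close> had a kernel sum above
    \<open>C0 * L + 1\<close>, integration over \<open>S\<close> would give at least
    \<open>C0 * L * p + p\<close>, whereas the bound on the potential allows at most
    \<open>L * n\<close>, hence at most \<open>C0 * L * p\<close>.\<close>
  have "of_nat n / p < \<top>"
    using p by (simp add: ennreal_divide_eq_top_iff less_top[symmetric])
  then obtain C0 where C0: "of_nat n / p \<le> of_nat C0"
    using ennreal_Ex_less_of_nat[of "of_nat n / p"] less_imp_le by blast
  have step: "\<exists>z\<in>S. (\<Sum>i<L. riesz_kernel s (y i) z) \<le> of_nat (C0 * L + 1)"
    if y: "\<And>i. i < L \<Longrightarrow> y i \<in> S" for y L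
  proof (rule ccontr)
    assume "\<not> ?thesis"
    then have "of_nat (C0 * L + 1) * indicator S z \<le> (\<Sum>i<L. riesz_kernel s (y i) z)" for z
      by (auto simp: not_le indicator_def intro: less_imp_le)
    then have "(\<integral>\<^sup>+z. of_nat (C0 * L + 1) * indicator S z \<partial>\<mu>) \<le> (\<integral>\<^sup>+z. (\<Sum>i<L. riesz_kernel s (y i) z) \<partial>\<mu>)"
      by (intro nn_integral_mono)
    also have "\<dots> = (\<Sum>i<L. \<integral>\<^sup>+z. riesz_kernel s (y i) z \<partial>\<mu>)"
      by (intro nn_integral_sum) measurable
    also have "\<dots> \<le> (\<Sum>i<L. of_nat n)"
      using y U by (intro sum_mono) auto
    also have "\<dots> = of_nat L * (of_nat n / p * p)"
      using ennreal_divide_self[OF p(1)] p(2) by (simp add: ennreal_divide_times top.not_eq_extremum[symmetric])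
    also have "\<dots> \<le> of_nat L * (of_nat C0 * p)"
      using C0 by (intro mult_left_mono mult_right_mono) auto
    also have "(\<integral>\<^sup>+z. of_nat (C0 * L + 1) * indicator S z \<partial>\<mu>) = of_nat (C0 * L + 1) * p"
      using S assms(1) by (simp add: p_def nn_integral_cmult_indicator)
    finally have "of_nat (C0 * L) * p + p \<le> of_nat (C0 * L) * p"
      by (simp add: algebra_simps)
    then show False
      using p by (cases p) (auto simp: ennreal_of_nat_eq_real_of_nat ennreal_mult''[symmetric] simp flip: ennreal_plus)
  qed
  have "\<exists>y. (\<forall>i<L. y i \<in> S) \<and> (\<Sum>j<L. \<Sum>i<j. riesz_kernel s (y i) (y j)) \<le> of_nat ((C0 + 1) * L\<^sup>2)" for L
  proof (induction L)
    case 0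
    show ?case by auto
  next
    case (Suc L)
    then obtain y where y: "\<And>i. i < L \<Longrightarrow> y i \<in> S"
        "(\<Sum>j<L. \<Sum>i<j. riesz_kernel s (y i) (y j)) \<le> of_nat ((C0 + 1) * L\<^sup>2)"
      by blast
    from step[of L y] y(1) obtain z where z: "z \<in> S" "(\<Sum>i<L. riesz_kernel s (y i) z) \<le> of_nat (C0 * L + 1)"
      by blast
    define y' where "y' = y(L := z)"
    have "(\<Sum>j<Suc L. \<Sum>i<j. riesz_kernel s (y' i) (y' j))
        = (\<Sum>j<L. \<Sum>i<j. riesz_kernel s (y i) (y j)) + (\<Sum>i<L. riesz_kernel s (y i) z)"
      by (auto simp: y'_def intro!: arg_cong2[where f = "(+)"] sum.cong)
    also have "\<dots> \<le> of_nat ((C0 + 1) * L\<^sup>2) + of_nat (C0 * L + 1)"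
      by (intro add_mono y z)
    also have "\<dots> = of_nat ((C0 + 1) * L\<^sup>2 + (C0 * L + 1))"
      by simp
    also have "\<dots> \<le> of_nat ((C0 + 1) * (Suc L)\<^sup>2)"
      by (intro of_nat_mono) (simp add: power2_eq_square algebra_simps)
    finally have "(\<Sum>j<Suc L. \<Sum>i<j. riesz_kernel s (y' i) (y' j)) \<le> of_nat ((C0 + 1) * (Suc L)\<^sup>2)" .
    moreover have "\<forall>i<Suc L. y' i \<in> S"
      using y z by (auto simp: y'_def less_Suc_eq)
    ultimately show ?case by blast
  qed
  then show thesis
    using that[of "C0 + 1"] unfolding pairwise_bounded_def by blast
qed

text \<open>Finite energy forces the potential \<open>U\<close> to be finite almost everywhere, so
  the sets \<open>S n\<close> cover almost every point and one of them has positive mass; the greedy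
  choice takes place there. \<open>A n\<close> is not assumed to be Borel; using its closure makes
  \<open>S n\<close> Borel. Since \<open>A\<close> increases, one index can serve both the set and
  the bound on \<open>U\<close>.\<close>

lemma pairwise_bounded_of_riesz_capacity_pos:
  fixes A :: "nat \<Rightarrow> 'a::euclidean_space set"
  assumes "0 < riesz_capacity s (\<Union>n. A n)" and A: "incseq A"
  obtains n C where "\<And>L. pairwise_bounded s C L (closure (A n))"
proof -
  from assms(1) obtain \<mu> where \<mu>: "\<mu> \<in> compact_prob_measures (\<Union>n. A n)" "riesz_energy s \<mu> < \<top>"
    unfolding riesz_capacity_pos_iff by blast
  then interpret prob_space \<mu>
    by (simp add: compact_prob_measures_def)
  have sets [measurable_cong]: "sets \<mu> = sets borel"
    using \<mu> by (simp add: compact_prob_measures_def)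
  define U where "U x = (\<integral>\<^sup>+y. riesz_kernel s x y \<partial>\<mu>)" for x
  have U [measurable]: "U \<in> borel_measurable \<mu>"
    unfolding U_def by measurable
  then have U_borel [measurable]: "U \<in> borel_measurable borel"
    by (simp add: measurable_cong_sets[OF sets refl])
  define S where "S n = {x \<in> closure (A n). U x \<le> of_nat n}" for n
  have S: "S n \<in> sets borel" for n
  proof -
    have "S n = closure (A n) \<inter> {x \<in> space borel. U x \<le> of_nat n}"
      by (auto simp: S_def)
    also have "\<dots> \<in> sets borel"
      by (intro sets.Int) measurable
    finally show ?thesis .
  qed
  have "integral\<^sup>N \<mu> U \<noteq> \<infinity>"
    using \<mu>(2) unfolding riesz_energy_eq U_def by auto
  then have "AE x in \<mu>. U x \<noteq> \<infinity>"
    by (intro nn_integral_PInf_AE U)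
  moreover have "AE x in \<mu>. x \<in> (\<Union>n. A n)"
    using AE_measure_support[OF sets]
  proof eventually_elim
    case (elim x)
    then show ?case
      using \<mu>(1) by (auto simp: compact_prob_measures_def)
  qed
  ultimately have "AE x in \<mu>. x \<in> (\<Union>n. S n)"
  proof eventually_elim
    case (elim x)
    then obtain n where "x \<in> A n" by auto
    moreover obtain m where "U x \<le> of_nat m"
      using elim(1) ennreal_Ex_less_of_nat[of "U x"] less_imp_le
      by (metis infinity_ennreal_def top.not_eq_extremum)
    ultimately have "x \<in> A (max n m)" "U x \<le> of_nat (max n m)"
      using incseqD[OF A, of n "max n m"] by (auto intro: order_trans simp: max_def)
    then have "x \<in> S (max n m)"
      using closure_subset by (auto simp: S_def)
    then show ?case by blast
  qed
  then have "\<not> (\<forall>n. S n \<in> null_sets \<mu>)"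
  proof (intro notI)
    assume "AE x in \<mu>. x \<in> (\<Union>n. S n)" "\<forall>n. S n \<in> null_sets \<mu>"
    then have "(\<Union>n. S n) \<in> null_sets \<mu>" by auto
    then have "AE x in \<mu>. x \<notin> (\<Union>n. S n)"
      by (rule AE_not_in)
    with \<open>AE x in \<mu>. x \<in> (\<Union>n. S n)\<close> have "AE x in \<mu>. False"
      by eventually_elim blast
    then show False by simp
  qed
  then obtain n where "0 < emeasure \<mu> (S n)"
    using S sets by (auto simp: null_sets_def zero_less_iff_neq_zero)
  moreover have "(\<integral>\<^sup>+y. riesz_kernel s x y \<partial>\<mu>) \<le> of_nat n" if "x \<in> S n" for x
    using that by (simp add: S_def U_def)
  ultimately obtain C where C: "\<And>L. pairwise_bounded s C L (S n)"
    using pairwise_bounded_of_potential_bounded[OF sets prob_space_axioms S] by metis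
  have "S n \<subseteq> closure (A n)"
    by (auto simp: S_def)
  from pairwise_bounded_mono[OF C this order_refl] show thesis
    by (rule that)
qed

text \<open>Points of \<open>A\<close> are limits of points of \<open>B\<close>, and the finite
  kernel sum converges along with them. Raising \<open>C\<close> to \<open>C + 1\<close> makes the
  bound strict for nonzero \<open>L\<close>, so that it holds eventually along the
  approximation.\<close>

lemma pairwise_bounded_dense:
  assumes "0 < s" "pairwise_bounded s C L A" "A \<subseteq> closure B"
  shows "pairwise_bounded s (C + 1) L B"
proof (cases "L = 0")
  case False
  from assms(2) obtain y where
    y: "\<And>i. i < L \<Longrightarrow> y i \<in> A" "(\<Sum>j<L. \<Sum>i<j. riesz_kernel s (y i) (y j)) \<le> of_nat (C * L\<^sup>2)"
    unfolding pairwise_bounded_def by blast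
  have "\<exists>u. (\<forall>k. u k \<in> B) \<and> u \<longlonglongrightarrow> y i" if "i < L" for i
    using y(1)[OF that] assms(3) closure_sequential by blast
  then obtain u where u: "\<And>i k. i < L \<Longrightarrow> u i k \<in> B" "\<And>i. i < L \<Longrightarrow> u i \<longlonglongrightarrow> y i"
    by metis
  have "(\<lambda>k. \<Sum>j<L. \<Sum>i<j. riesz_kernel s (u i k) (u j k)) \<longlonglongrightarrow> (\<Sum>j<L. \<Sum>i<j. riesz_kernel s (y i) (y j))"
    using u by (intro tendsto_sum tendsto_riesz_kernel assms) auto
  moreover have "(\<Sum>j<L. \<Sum>i<j. riesz_kernel s (y i) (y j)) < of_nat ((C + 1) * L\<^sup>2)"
  proof -
    have "(of_nat (C * L\<^sup>2) :: ennreal) < of_nat ((C + 1) * L\<^sup>2)"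
      using False by (simp only: of_nat_less_iff) simp
    with y(2) show ?thesis by (rule le_less_trans)
  qed
  ultimately have "\<forall>\<^sub>F k in sequentially. (\<Sum>j<L. \<Sum>i<j. riesz_kernel s (u i k) (u j k)) < of_nat ((C + 1) * L\<^sup>2)"
    by (rule order_tendstoD)
  then obtain k where "(\<Sum>j<L. \<Sum>i<j. riesz_kernel s (u i k) (u j k)) < of_nat ((C + 1) * L\<^sup>2)"
    by (auto simp: eventually_sequentially)
  then show ?thesis
    unfolding pairwise_bounded_def using u(1) by (intro exI[of _ "\<lambda>i. u i k"]) auto
qed (simp add: pairwise_bounded_def)

section \<open>Cadlag paths\<close>

text \<open>If \<open>\<tau>\<close> is infinitely often at or to the right of \<open>t\<close>,
  right continuity gives the cluster value \<open>f t\<close> along those indices. Otherwise it is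
  eventually to the left of \<open>t\<close>, which forces \<open>0 < t\<close>, and the left limit
  is reached. The filter \<open>F\<close> plays the part of a subsequence.\<close>

lemma cadlag_cluster:
  fixes f :: "real \<Rightarrow> 'a::topological_space"
  assumes f: "cadlag f" and \<tau>: "\<And>k. 0 \<le> \<tau> k" "\<tau> \<longlonglongrightarrow> t"
  obtains F l where "F \<noteq> bot" "F \<le> sequentially" "((\<lambda>k. f (\<tau> k)) \<longlongrightarrow> l) F"
    "l = f t \<or> 0 < t \<and> (f \<longlongrightarrow> l) (at_left t)"
proof -
  have "0 \<le> t"
    using LIMSEQ_le_const[OF \<tau>(2)] \<tau>(1) by auto
  show thesis
  proof (cases "\<exists>\<^sub>F k in sequentially. t \<le> \<tau> k")
    case True
    define F where "F = inf sequentially (principal {k. t \<le> \<tau> k})"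
    have "F \<noteq> bot"
      using True by (auto simp: F_def trivial_limit_def eventually_inf_principal frequently_def)
    moreover have "F \<le> sequentially"
      by (simp add: F_def)
    moreover have "((\<lambda>k. f (\<tau> k)) \<longlongrightarrow> f t) F"
    proof (rule topological_tendstoI)
      fix S assume S: "open S" "f t \<in> S"
      have "(f \<longlongrightarrow> f t) (at_right t)"
        using f \<open>0 \<le> t\<close> by (simp add: cadlag_def)
      then have "\<forall>\<^sub>F x in at_right t. f x \<in> S"
        using S by (auto dest: topological_tendstoD)
      then obtain b where b: "t < b" "\<And>x. t < x \<Longrightarrow> x < b \<Longrightarrow> f x \<in> S"
        by (auto simp: eventually_at_right_field)
      have "\<forall>\<^sub>F k in sequentially. \<tau> k < b"
        using \<tau>(2) b(1) by (rule order_tendstoD)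
      then show "\<forall>\<^sub>F k in F. f (\<tau> k) \<in> S"
        unfolding F_def eventually_inf_principal
        by eventually_elim (use b S in \<open>auto simp: order_le_less\<close>)
    qed
    ultimately show thesis
      by (rule that) simp
  next
    case False
    then have ev: "\<forall>\<^sub>F k in sequentially. \<tau> k < t"
      by (simp add: not_frequently not_le)
    then obtain k where "\<tau> k < t"
      by (auto simp: eventually_sequentially)
    with \<tau>(1)[of k] have "0 < t" by simp
    then obtain l where l: "(f \<longlongrightarrow> l) (at_left t)"
      using f by (auto simp: cadlag_def)
    have "filterlim \<tau> (at_left t) sequentially"
      using \<tau>(2) ev by (rule tendsto_imp_filterlim_at_left)
    with l have "(\<lambda>k. f (\<tau> k)) \<longlonglongrightarrow> l"
      by (rule filterlim_compose)
    from that[OF sequentially_bot order_refl this] \<open>0 < t\<close> l show thesis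
      by simp
  qed
qed

lemma cadlag_graph_limit:
  fixes f :: "real \<Rightarrow> 'a::t2_space"
  assumes "cadlag f" "\<And>k. 0 \<le> \<tau> k" "\<tau> \<longlonglongrightarrow> t" "(\<lambda>k. f (\<tau> k)) \<longlonglongrightarrow> x"
  shows "x = f t \<or> 0 < t \<and> (f \<longlongrightarrow> x) (at_left t)"
proof -
  obtain F l where F: "F \<noteq> bot" "F \<le> sequentially" "((\<lambda>k. f (\<tau> k)) \<longlongrightarrow> l) F"
    and l: "l = f t \<or> 0 < t \<and> (f \<longlongrightarrow> l) (at_left t)"
    using cadlag_cluster[OF assms(1-3)] .
  have "x = l"
    using F assms(4) by (auto intro: tendsto_unique tendsto_mono)
  with l show ?thesis by simp
qed

text \<open>Times at which the values exceed all bounds would have a convergent subsequence, along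
  which \<open>cadlag_cluster\<close> provides a finite cluster value.\<close>

lemma cadlag_bounded:
  fixes f :: "real \<Rightarrow> 'a::real_normed_vector"
  assumes f: "cadlag f" and "0 \<le> a"
  shows "\<exists>R. \<forall>t\<in>{a..b}. norm (f t) \<le> R"
proof (rule ccontr)
  assume "\<not> ?thesis"
  then have "\<exists>t\<in>{a..b}. real k < norm (f t)" for k
    by (meson not_le)
  then obtain \<tau> where \<tau>: "\<And>k. \<tau> k \<in> {a..b}" "\<And>k. real k < norm (f (\<tau> k))"
    by metis
  have "seq_compact {a..b}"
    using compact_Icc compact_imp_seq_compact by blast
  with \<tau>(1) obtain t r where r: "strict_mono r" "(\<tau> \<circ> r) \<longlonglongrightarrow> t"
    unfolding seq_compact_def by metis
  have "0 \<le> (\<tau> \<circ> r) k" for k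
    using \<tau>(1)[of "r k"] \<open>0 \<le> a\<close> by simp
  then obtain F l where F: "F \<noteq> bot" "F \<le> sequentially" "((\<lambda>k. f ((\<tau> \<circ> r) k)) \<longlongrightarrow> l) F"
    using cadlag_cluster[OF f _ r(2)] by metis
  have "filterlim (\<lambda>k. norm (f ((\<tau> \<circ> r) k))) at_top sequentially"
  proof (rule filterlim_at_top_mono[OF filterlim_real_sequentially always_eventually, rule_format])
    show "real k \<le> norm (f ((\<tau> \<circ> r) k))" for k
      using \<tau>(2)[of "r k"] seq_suble[OF r(1), of k] by simp
  qed
  then have "filterlim (\<lambda>k. norm (f ((\<tau> \<circ> r) k))) at_top F"
    using F(2) by (rule filterlim_mono[OF _ order_refl])
  moreover have "((\<lambda>k. norm (f ((\<tau> \<circ> r) k))) \<longlongrightarrow> norm l) F"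
    using F(3) by (rule tendsto_norm)
  ultimately show False
    using not_tendsto_and_filterlim_at_infinity[OF F(1)] filterlim_at_top_imp_at_infinity by blast
qed

text \<open>A jump time \<open>t\<close> is labelled by a basic open set containing
  \<open>f t\<close> and a rational \<open>q < t\<close> such that \<open>f\<close> avoids that set
  strictly between \<open>q\<close> and \<open>t\<close>. Jump times \<open>s < t\<close> cannot
  share a label, since \<open>f s\<close> would both lie in the set and avoid it.\<close>

lemma countable_cadlag_jump_times:
  fixes f :: "real \<Rightarrow> 'a::{second_countable_topology, t2_space}"
  shows "countable {t. \<exists>l. (f \<longlongrightarrow> l) (at_left t) \<and> l \<noteq> f t}" (is "countable ?D")
proof -
  obtain \<B> :: "'a set set" where \<B>: "countable \<B>" "topological_basis \<B>"
    using ex_countable_basis[where 'a = 'a] by auto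
  define P where "P t V \<longleftrightarrow> fst V \<in> \<B> \<and> snd V \<in> \<rat> \<and> f t \<in> fst V \<and> snd V < t
      \<and> (\<forall>s. snd V < s \<and> s < t \<longrightarrow> f s \<notin> fst V)" for t and V :: "'a set \<times> real"
  have "\<exists>V. P t V" if "t \<in> ?D" for t
  proof -
    from that obtain l where l: "(f \<longlongrightarrow> l) (at_left t)" "l \<noteq> f t" by blast
    from hausdorff[OF l(2)] obtain V W where VW: "open V" "open W" "l \<in> V" "f t \<in> W" "V \<inter> W = {}"
      by metis
    from topological_basisE[OF \<B>(2) VW(2,4)] obtain U where U: "U \<in> \<B>" "f t \<in> U" "U \<subseteq> W"
      by metis
    have "\<forall>\<^sub>F s in at_left t. f s \<in> V"
      using l(1) VW by (auto dest: topological_tendstoD)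
    then obtain b where b: "b < t" "\<And>s. b < s \<Longrightarrow> s < t \<Longrightarrow> f s \<in> V"
      by (auto simp: eventually_at_left_field)
    obtain q where q: "q \<in> \<rat>" "b < q" "q < t"
      using Rats_dense_in_real[OF b(1)] by blast
    have "f s \<notin> U" if "q < s" "s < t" for s
      using b(2)[of s] that q(2) U(3) VW(5) by auto
    then show ?thesis
      using U q by (intro exI[of _ "(U, q)"]) (simp add: P_def)
  qed
  then have "\<exists>V. \<forall>t\<in>?D. P t (V t)"
    by (intro bchoice ballI)
  then obtain V where V: "\<forall>t\<in>?D. P t (V t)" ..
  have inj: "inj_on V ?D"
  proof (rule linorder_inj_onI')
    fix s t assume st: "s \<in> ?D" "t \<in> ?D" "s < t"
    show "V s \<noteq> V t"
      using bspec[OF V st(1)] bspec[OF V st(2)] st(3) by (auto simp: P_def)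
  qed
  have sub: "V ` ?D \<subseteq> \<B> \<times> \<rat>"
  proof (rule image_subsetI)
    fix t assume "t \<in> ?D"
    from bspec[OF V this] show "V t \<in> \<B> \<times> \<rat>"
      by (simp add: P_def mem_Times_iff)
  qed
  have "countable (\<B> \<times> (\<rat> :: real set))"
    using \<B>(1) by (simp add: countable_rat)
  from countable_image_inj_on[OF countable_subset[OF sub this] inj] show ?thesis .
qed

lemma countable_cadlag_jumps:
  fixes f :: "real \<Rightarrow> 'a::{second_countable_topology, real_normed_vector}"
  shows "countable {f t - l | t l. (f \<longlongrightarrow> l) (at_left t)}"
proof (rule countable_subset)
  show "{f t - l | t l. (f \<longlongrightarrow> l) (at_left t)}
      \<subseteq> insert 0 ((\<lambda>t. f t - Lim (at_left t) f) ` {t. \<exists>l. (f \<longlongrightarrow> l) (at_left t) \<and> l \<noteq> f t})"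
  proof clarify
    fix t l assume l: "(f \<longlongrightarrow> l) (at_left t)"
      and *: "f t - l \<notin> (\<lambda>t. f t - Lim (at_left t) f) ` {t. \<exists>l. (f \<longlongrightarrow> l) (at_left t) \<and> l \<noteq> f t}"
    have "Lim (at_left t) f = l"
      using l by (intro tendsto_Lim) auto
    with l * show "f t - l = 0"
      by (cases "l = f t") auto
  qed
  show "countable (insert 0 ((\<lambda>t. f t - Lim (at_left t) f) ` {t. \<exists>l. (f \<longlongrightarrow> l) (at_left t) \<and> l \<noteq> f t}))"
    by (intro countable_insert countable_image countable_cadlag_jump_times)
qed

text \<open>The step functions \<open>f (d n t)\<close> converge, because \<open>d n t\<close> is a
  dyadic point strictly to the right of \<open>max 0 t\<close> and the right limit applies. The
  truncation keeps away from negative times, about which \<open>cadlag\<close> says nothing.\<close>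

lemma borel_measurable_cadlag:
  fixes f :: "real \<Rightarrow> 'a::euclidean_space"
  assumes f: "cadlag f"
  shows "(\<lambda>t. f (max 0 t)) \<in> borel_measurable borel"
proof (rule borel_measurable_LIMSEQ_metric)
  define d where "d n t = (of_int \<lfloor>2 ^ n * max 0 t\<rfloor> + 1) / (2 ^ n :: real)" for n :: nat and t :: real
  show "(\<lambda>t. f (d n t)) \<in> borel_measurable borel" for n
  proof -
    have "(\<lambda>t::real. \<lfloor>2 ^ n * max 0 t\<rfloor>) \<in> measurable borel (count_space UNIV)"
      by measurable
    from measurable_compose[OF this, of "\<lambda>k. f ((of_int k + 1) / 2 ^ n)" borel] show ?thesis
      by (simp add: d_def)
  qed
  fix t :: real
  have d: "max 0 t < d n t" "d n t \<le> max 0 t + (1 / 2) ^ n" for n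
  proof -
    have "2 ^ n * max 0 t < of_int \<lfloor>2 ^ n * max 0 t\<rfloor> + 1" "of_int \<lfloor>2 ^ n * max 0 t\<rfloor> \<le> 2 ^ n * max 0 t"
      by linarith+
    moreover have "(max 0 t + (1 / 2) ^ n) * 2 ^ n = max 0 t * 2 ^ n + 1"
      by (simp add: algebra_simps flip: power_mult_distrib)
    ultimately show "max 0 t < d n t" "d n t \<le> max 0 t + (1 / 2) ^ n"
      by (simp_all only: d_def pos_less_divide_eq[OF zero_less_power[OF zero_less_numeral]]
        pos_divide_le_eq[OF zero_less_power[OF zero_less_numeral]]) (simp_all add: mult.commute)
  qed
  have "(\<lambda>n. (1 / 2 :: real) ^ n) \<longlonglongrightarrow> 0"
    by (intro LIMSEQ_power_zero) simp
  from tendsto_add[OF tendsto_const[of "max 0 t"] this] have "(\<lambda>n. max 0 t + (1 / 2) ^ n) \<longlonglongrightarrow> max 0 t"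
    by simp
  from tendsto_sandwich[OF _ _ tendsto_const this, of "\<lambda>n. d n t"] d
  have "(\<lambda>n. d n t) \<longlonglongrightarrow> max 0 t"
    by (simp add: less_imp_le)
  then have "filterlim (\<lambda>n. d n t) (at_right (max 0 t)) sequentially"
    using d(1) by (intro tendsto_imp_filterlim_at_right always_eventually allI)
  moreover have "(f \<longlongrightarrow> f (max 0 t)) (at_right (max 0 t))"
    using f by (simp add: cadlag_def)
  ultimately show "(\<lambda>n. f (d n t)) \<longlonglongrightarrow> f (max 0 t)"
    by (rule filterlim_compose[rotated])
qed

section \<open>Images of cubes and of their dyadic grids, for fixed paths\<close>

definition block_range :: "nat \<Rightarrow> (nat \<Rightarrow> real \<Rightarrow> 'a::euclidean_space) \<Rightarrow> real \<Rightarrow> real \<Rightarrow> 'a set" where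
  "block_range N x a b = {\<Sum>j\<in>{1..N}. x j (t j) | t. \<forall>j\<in>{1..N}. t j \<in> {a..b}}"

definition dyadic_range :: "nat \<Rightarrow> (nat \<Rightarrow> real \<Rightarrow> 'a::euclidean_space) \<Rightarrow> real \<Rightarrow> nat \<Rightarrow> nat \<Rightarrow> 'a set" where
  "dyadic_range N x a n m = {\<Sum>j\<in>{1..N}. x j (a + real (l j) / 2 ^ m) | l. \<forall>j\<in>{1..N}. l j \<le> n * 2 ^ m}"

lemma block_range_mono: "a' \<le> a \<Longrightarrow> b \<le> b' \<Longrightarrow> block_range N x a b \<subseteq> block_range N x a' b'"
  unfolding block_range_def by (intro Collect_mono ex_mono impI conj_mono imp_refl) auto

lemma dyadic_range_subset: "dyadic_range N x a n m \<subseteq> block_range N x a (a + real n)"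
proof
  fix z assume "z \<in> dyadic_range N x a n m"
  then obtain l where l: "z = (\<Sum>j\<in>{1..N}. x j (a + real (l j) / 2 ^ m))" "\<And>j. j \<in> {1..N} \<Longrightarrow> l j \<le> n * 2 ^ m"
    by (auto simp: dyadic_range_def)
  have "a + real (l j) / 2 ^ m \<in> {a..a + real n}" if "j \<in> {1..N}" for j
  proof -
    have "real (l j) \<le> real (n * 2 ^ m)"
      using l(2)[OF that] by (rule of_nat_mono)
    then show ?thesis by (simp add: field_simps)
  qed
  with l(1) show "z \<in> block_range N x a (a + real n)"
    unfolding block_range_def mem_Collect_eq by (intro exI[of _ "\<lambda>j. a + real (l j) / 2 ^ m"]) auto
qed

lemma dyadic_range_mono: "m \<le> m' \<Longrightarrow> dyadic_range N x a n m \<subseteq> dyadic_range N x a n m'"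
proof
  fix z assume m: "m \<le> m'" and "z \<in> dyadic_range N x a n m"
  then obtain l where l: "z = (\<Sum>j\<in>{1..N}. x j (a + real (l j) / 2 ^ m))" "\<forall>j\<in>{1..N}. l j \<le> n * 2 ^ m"
    by (auto simp: dyadic_range_def)
  have pow: "(2 :: 'b::comm_semiring_1) ^ m' = 2 ^ m * 2 ^ (m' - m)"
    using m by (simp flip: power_add)
  have "z = (\<Sum>j\<in>{1..N}. x j (a + real (l j * 2 ^ (m' - m)) / 2 ^ m'))"
    unfolding l(1) pow by simp
  moreover have "\<forall>j\<in>{1..N}. l j * 2 ^ (m' - m) \<le> n * 2 ^ m'"
    using l(2) by (auto simp: pow mult.assoc[symmetric])
  ultimately show "z \<in> dyadic_range N x a n m'"
    unfolding dyadic_range_def mem_Collect_eq by (intro exI[of _ "\<lambda>j. l j * 2 ^ (m' - m)"] conjI)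
qed

text \<open>Times are rounded up to the grid, so right continuity carries the values to the limit.
  The right end \<open>a + real n\<close> belongs to every grid, hence rounding up never leaves the
  block.\<close>

lemma block_range_subset_closure:
  assumes x: "\<And>j. j \<in> {1..N} \<Longrightarrow> cadlag (x j)" and "0 \<le> a"
  shows "block_range N x a (a + real n) \<subseteq> closure (\<Union>m. dyadic_range N x a n m)"
proof
  fix z assume "z \<in> block_range N x a (a + real n)"
  then obtain t where t: "z = (\<Sum>j\<in>{1..N}. x j (t j))" "\<And>j. j \<in> {1..N} \<Longrightarrow> t j \<in> {a..a + real n}"
    by (auto simp: block_range_def)
  define l where "l m j = nat \<lceil>(t j - a) * 2 ^ m\<rceil>" for m j
  have real_l: "real (l m j) = of_int \<lceil>(t j - a) * 2 ^ m\<rceil>" if "j \<in> {1..N}" for m j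
    using t(2)[OF that] by (simp add: l_def)
  have l_le: "l m j \<le> n * 2 ^ m" if "j \<in> {1..N}" for m j
  proof -
    have "(t j - a) * 2 ^ m \<le> real_of_int (int (n * 2 ^ m))"
      using t(2)[OF that] by simp
    then show ?thesis
      by (simp only: l_def nat_le_iff ceiling_le_iff)
  qed
  have lim: "(\<lambda>m. x j (a + real (l m j) / 2 ^ m)) \<longlonglongrightarrow> x j (t j)" if j: "j \<in> {1..N}" for j
  proof -
    have d: "t j \<le> a + real (l m j) / 2 ^ m" "a + real (l m j) / 2 ^ m \<le> t j + (1 / 2) ^ m" for m
    proof -
      have "(t j - a) * 2 ^ m \<le> real (l m j)" "real (l m j) \<le> (t j - a) * 2 ^ m + 1"
        unfolding real_l[OF j] by linarith+
      moreover have "(t j + (1 / 2) ^ m - a) * 2 ^ m = (t j - a) * 2 ^ m + 1"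
        by (simp add: algebra_simps flip: power_mult_distrib)
      ultimately have "t j - a \<le> real (l m j) / 2 ^ m" "real (l m j) / 2 ^ m \<le> t j + (1 / 2) ^ m - a"
        by (simp_all add: pos_le_divide_eq pos_divide_le_eq)
      then show "t j \<le> a + real (l m j) / 2 ^ m" "a + real (l m j) / 2 ^ m \<le> t j + (1 / 2) ^ m"
        by simp_all
    qed
    have "(\<lambda>m. (1 / 2 :: real) ^ m) \<longlonglongrightarrow> 0"
      by (intro LIMSEQ_power_zero) simp
    from tendsto_add[OF tendsto_const[of "t j"] this] have "(\<lambda>m. t j + (1 / 2) ^ m) \<longlonglongrightarrow> t j"
      by simp
    from tendsto_sandwich[OF _ _ tendsto_const this, of "\<lambda>m. a + real (l m j) / 2 ^ m"] d
    have lim: "(\<lambda>m. a + real (l m j) / 2 ^ m) \<longlonglongrightarrow> t j"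
      by simp
    show ?thesis
    proof (rule topological_tendstoI)
      fix S assume S: "open S" "x j (t j) \<in> S"
      have "(x j \<longlongrightarrow> x j (t j)) (at_right (t j))"
        using x[OF j] t(2)[OF j] \<open>0 \<le> a\<close> by (simp add: cadlag_def)
      then have "\<forall>\<^sub>F s in at_right (t j). x j s \<in> S"
        using S by (auto dest: topological_tendstoD)
      then obtain b where b: "t j < b" "\<And>s. t j < s \<Longrightarrow> s < b \<Longrightarrow> x j s \<in> S"
        by (auto simp: eventually_at_right_field)
      have "\<forall>\<^sub>F m in sequentially. a + real (l m j) / 2 ^ m < b"
        using lim b(1) by (rule order_tendstoD)
      then show "\<forall>\<^sub>F m in sequentially. x j (a + real (l m j) / 2 ^ m) \<in> S"
        by eventually_elim (metis S(2) b(2) d(1) order_le_less)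
    qed
  qed
  have "(\<lambda>m. \<Sum>j\<in>{1..N}. x j (a + real (l m j) / 2 ^ m)) \<longlonglongrightarrow> z"
    unfolding t(1) by (intro tendsto_sum lim)
  moreover have "(\<Sum>j\<in>{1..N}. x j (a + real (l m j) / 2 ^ m)) \<in> (\<Union>m. dyadic_range N x a n m)" for m
    unfolding dyadic_range_def using l_le by (intro UN_I[of m] CollectI exI[of _ "l m"]) auto
  ultimately show "z \<in> closure (\<Union>m. dyadic_range N x a n m)"
    unfolding closure_sequential by (intro exI conjI allI)
qed

section \<open>Measures of finite energy on the range\<close>

lemma nn_integral_distr_twice:
  assumes M: "prob_space M" and f [measurable]: "f \<in> measurable M N"
    and h [measurable]: "(\<lambda>(u, v). h u v) \<in> borel_measurable (N \<Otimes>\<^sub>M N)"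
  shows "(\<integral>\<^sup>+u. \<integral>\<^sup>+v. h u v \<partial>distr M N f \<partial>distr M N f) = (\<integral>\<^sup>+u. \<integral>\<^sup>+v. h (f u) (f v) \<partial>M \<partial>M)"
proof -
  interpret D: prob_space "distr M N f"
    using M f by (rule prob_space.prob_space_distr)
  have h' [measurable]: "(\<lambda>(u, v). h u v) \<in> borel_measurable (N \<Otimes>\<^sub>M distr M N f)"
    by (simp add: measurable_cong_sets[OF sets_pair_measure_cong[OF refl sets_distr] refl])
  have "(\<integral>\<^sup>+u. \<integral>\<^sup>+v. h u v \<partial>distr M N f \<partial>distr M N f) = (\<integral>\<^sup>+u. \<integral>\<^sup>+v. h (f u) v \<partial>distr M N f \<partial>M)"
    using D.borel_measurable_nn_integral_fst[OF h'] by (intro nn_integral_distr f) simp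
  also have "\<dots> = (\<integral>\<^sup>+u. \<integral>\<^sup>+v. h (f u) (f v) \<partial>M \<partial>M)"
  proof (rule nn_integral_cong)
    fix u assume "u \<in> space M"
    then have "f u \<in> space N"
      by (rule measurable_space[OF f])
    then have "h (f u) \<in> borel_measurable N"
      using measurable_compose[OF measurable_Pair1' h, of "f u"] by simp
    then show "(\<integral>\<^sup>+v. h (f u) v \<partial>distr M N f) = (\<integral>\<^sup>+v. h (f u) (f v) \<partial>M)"
      by (intro nn_integral_distr f) simp
  qed
  finally show ?thesis .
qed

lemma sum_symmetric_eq:
  fixes g :: "nat \<Rightarrow> nat \<Rightarrow> 'b::comm_semiring_1"
  assumes "\<And>i j. g i j = g j i"
  shows "(\<Sum>i<n. \<Sum>j<n. g i j) = (\<Sum>j<n. g j j) + 2 * (\<Sum>j<n. \<Sum>i<j. g i j)"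
proof (induction n)
  case (Suc n)
  have "(\<Sum>i<Suc n. \<Sum>j<Suc n. g i j) = (\<Sum>i<n. \<Sum>j<n. g i j) + (\<Sum>i<n. g i n) + (\<Sum>j<n. g n j) + g n n"
    by (simp add: sum.distrib algebra_simps)
  also have "(\<Sum>j<n. g n j) = (\<Sum>i<n. g i n)"
    using assms by (intro sum.cong) auto
  finally show ?case
    unfolding Suc by (simp add: algebra_simps mult_2)
qed simp

text \<open>Put \<open>n = Suc L\<close>. The truncation caps the diagonal terms, which are infinite
  for a positive exponent, at \<open>n\<close> each, \<open>n^2\<close> in total; the pairs off the
  diagonal count twice and contribute at most \<open>2 * C * n^2\<close>. Averaging divides by
  \<open>n^2\<close> and leaves a bound free of \<open>L\<close>.\<close>

lemma truncated_energy_le: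
  assumes "(\<Sum>j<Suc L. \<Sum>i<j. riesz_kernel s (y i) (y j)) \<le> of_nat (C * (Suc L)\<^sup>2)"
  shows "(\<integral>\<^sup>+i. \<integral>\<^sup>+j. min (of_nat (Suc L)) (riesz_kernel s (y i) (y j)) \<partial>measure_pmf (pmf_of_set {..<Suc L})
      \<partial>measure_pmf (pmf_of_set {..<Suc L})) \<le> of_nat (1 + 2 * C)"
proof -
  let ?n = "Suc L"
  define g where "g i j = min (of_nat ?n) (riesz_kernel s (y i) (y j))" for i j
  have "(\<Sum>i<?n. \<Sum>j<?n. g i j) = (\<Sum>j<?n. g j j) + 2 * (\<Sum>j<?n. \<Sum>i<j. g i j)"
    by (rule sum_symmetric_eq) (simp add: g_def riesz_kernel_commute)
  also have "\<dots> \<le> (\<Sum>j<?n. of_nat ?n) + 2 * (\<Sum>j<?n. \<Sum>i<j. riesz_kernel s (y i) (y j))"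
    by (intro add_mono sum_mono mult_left_mono) (auto simp: g_def)
  also have "\<dots> \<le> (\<Sum>j<?n. of_nat ?n) + 2 * of_nat (C * ?n\<^sup>2)"
    by (intro add_left_mono mult_left_mono assms) auto
  also have "\<dots> = of_nat (1 + 2 * C) * of_nat (?n * ?n)"
    by (simp add: power2_eq_square algebra_simps)
  finally have *: "(\<Sum>i<?n. \<Sum>j<?n. g i j) \<le> of_nat (1 + 2 * C) * of_nat (?n * ?n)" .
  have n: "(of_nat ?n :: ennreal) \<noteq> 0" "(of_nat ?n :: ennreal) \<noteq> \<top>"
    by (simp_all del: of_nat_Suc)
  have ne: "{..<?n} \<noteq> {}"
    by auto
  have "(\<integral>\<^sup>+i. \<integral>\<^sup>+j. g i j \<partial>measure_pmf (pmf_of_set {..<?n}) \<partial>measure_pmf (pmf_of_set {..<?n}))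
      = (\<Sum>i<?n. (\<Sum>j<?n. g i j) / of_nat ?n) / of_nat ?n"
    by (simp only: nn_integral_pmf_of_set[OF ne finite_lessThan] card_lessThan)
  also have "\<dots> = (\<Sum>i<?n. \<Sum>j<?n. g i j) / of_nat ?n / of_nat ?n"
    by (simp only: divide_ennreal_def sum_distrib_right)
  also have "\<dots> \<le> of_nat (1 + 2 * C) * of_nat (?n * ?n) / of_nat ?n / of_nat ?n"
    by (intro divide_right_mono_ennreal *)
  also have "\<dots> = of_nat (1 + 2 * C)"
    unfolding of_nat_mult mult.assoc[symmetric] using n
    by (simp only: ennreal_mult_divide_eq not_False_eq_True)
  finally show ?thesis
    unfolding g_def .
qed

text \<open>The uniform distributions on the \<open>L\<close>-th point set have, along a subsequence, a weak limit; by
  Skorohod's theorem the convergence may be assumed pointwise, so that Fatou's lemma applies to the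
  kernels truncated at level \<open>L\<close>.\<close>

lemma finite_energy_limit:
  fixes \<Phi> :: "real \<Rightarrow> 'a::euclidean_space"
  assumes "0 < s" and \<Phi>: "continuous_on UNIV \<Phi>" and \<sigma>: "\<And>L i. \<sigma> L i \<in> {0..1::real}"
    and bound: "\<And>L. (\<Sum>j<Suc L. \<Sum>i<j. riesz_kernel s (\<Phi> (\<sigma> L i)) (\<Phi> (\<sigma> L j))) \<le> of_nat (C * (Suc L)\<^sup>2)"
  obtains \<Omega> :: "real measure" and Z :: "nat \<Rightarrow> real \<Rightarrow> real" and Y :: "real \<Rightarrow> real" and r :: "nat \<Rightarrow> nat"
  where "prob_space \<Omega>" "Y \<in> borel_measurable \<Omega>" "\<And>\<omega>. \<omega> \<in> space \<Omega> \<Longrightarrow> (\<lambda>k. Z k \<omega>) \<longlonglongrightarrow> Y \<omega>"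
    "\<And>k. AE \<omega> in \<Omega>. Z k \<omega> \<in> \<sigma> (r k) ` {..<Suc (r k)}"
    "(\<integral>\<^sup>+u. \<integral>\<^sup>+v. riesz_kernel s (\<Phi> (Y u)) (\<Phi> (Y v)) \<partial>\<Omega> \<partial>\<Omega>) < \<top>"
proof -
  define p where "p L = measure_pmf (pmf_of_set {..<Suc L})" for L
  define \<mu> where "\<mu> L = distr (p L) borel (\<sigma> L)" for L
  have p: "prob_space (p L)" "sets (p L) = UNIV" for L
    by (simp_all add: p_def measure_pmf.prob_space_axioms)
  have \<sigma>_meas [measurable]: "\<sigma> L \<in> borel_measurable (p L)" for L
    by (simp add: p_def)
  have real: "real_distribution (\<mu> L)" for L
    unfolding \<mu>_def by (intro prob_space.real_distribution_distr p \<sigma>_meas)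
  have mass: "1 - \<epsilon> < measure (\<mu> L) {-1<..1}" if "0 < \<epsilon>" for \<epsilon> L
  proof -
    have *: "-1 < \<sigma> L i \<and> \<sigma> L i \<le> 1" for i L
      using \<sigma>[of L i] by auto
    have "measure (\<mu> L) {-1<..1} = measure (p L) (\<sigma> L -` {-1<..1} \<inter> space (p L))"
      unfolding \<mu>_def by (intro measure_distr) auto
    also have "\<sigma> L -` {-1<..1} \<inter> space (p L) = space (p L)"
      using * by auto
    finally show ?thesis
      using that p(1)[of L] by (simp add: prob_space.prob_space)
  qed
  have "tight \<mu>"
    unfolding tight_def
  proof (intro conjI allI impI real)
    fix \<epsilon> :: real assume "0 < \<epsilon>"
    then show "\<exists>a b. a < b \<and> (\<forall>L. 1 - \<epsilon> < measure (\<mu> L) {a<..b})"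
      by (rule_tac exI[of _ "-1"], rule_tac exI[of _ 1]) (simp add: mass)
  qed
  then obtain r \<nu> where r: "strict_mono r" and \<nu>: "real_distribution \<nu>" "weak_conv_m (\<mu> \<circ> id \<circ> r) \<nu>"
    using tight_imp_convergent_subsubsequence[of \<mu> id] by (auto simp: strict_mono_def)
  have "\<exists>(\<Omega> :: real measure) (Z :: nat \<Rightarrow> real \<Rightarrow> real) (Y :: real \<Rightarrow> real).
      prob_space \<Omega> \<and> (\<forall>k. Z k \<in> measurable \<Omega> borel) \<and> (\<forall>k. distr \<Omega> borel (Z k) = \<mu> (r k)) \<and>
      Y \<in> measurable \<Omega> lborel \<and> distr \<Omega> borel Y = \<nu> \<and> (\<forall>\<omega>\<in>space \<Omega>. (\<lambda>k. Z k \<omega>) \<longlonglongrightarrow> Y \<omega>)"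
    using \<nu> real by (intro Skorohod) (auto simp: comp_def)
  then obtain \<Omega> :: "real measure" and Z :: "nat \<Rightarrow> real \<Rightarrow> real" and Y :: "real \<Rightarrow> real" where
    *: "prob_space \<Omega> \<and> (\<forall>k. Z k \<in> measurable \<Omega> borel) \<and> (\<forall>k. distr \<Omega> borel (Z k) = \<mu> (r k)) \<and>
      Y \<in> measurable \<Omega> lborel \<and> distr \<Omega> borel Y = \<nu> \<and> (\<forall>\<omega>\<in>space \<Omega>. (\<lambda>k. Z k \<omega>) \<longlonglongrightarrow> Y \<omega>)"
    by (elim exE)
  have \<Omega>: "prob_space \<Omega>" and Z [measurable]: "\<And>k. Z k \<in> borel_measurable \<Omega>"
    and distr: "\<And>k. distr \<Omega> borel (Z k) = \<mu> (r k)" and Y [measurable]: "Y \<in> borel_measurable \<Omega>"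
    and lim: "\<And>\<omega>. \<omega> \<in> space \<Omega> \<Longrightarrow> (\<lambda>k. Z k \<omega>) \<longlonglongrightarrow> Y \<omega>"
    using * by simp_all
  interpret \<Omega>: prob_space \<Omega> by fact
  have \<Phi>_meas [measurable]: "\<Phi> \<in> borel_measurable borel"
    using \<Phi> by (rule borel_measurable_continuous_onI)
  define h where "h L u v = min (of_nat (Suc L)) (riesz_kernel s (\<Phi> u) (\<Phi> v))" for L u v
  have h [measurable]: "(\<lambda>z. h L (f z) (g z)) \<in> borel_measurable M"
    if [measurable]: "f \<in> borel_measurable M" "g \<in> borel_measurable M" for L f g and M :: "'b measure"
    unfolding h_def by measurable
  have h_le: "(\<integral>\<^sup>+u. \<integral>\<^sup>+v. h (r k) (Z k u) (Z k v) \<partial>\<Omega> \<partial>\<Omega>) \<le> of_nat (1 + 2 * C)" for k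
  proof -
    have "(\<integral>\<^sup>+u. \<integral>\<^sup>+v. h (r k) (Z k u) (Z k v) \<partial>\<Omega> \<partial>\<Omega>) = (\<integral>\<^sup>+u. \<integral>\<^sup>+v. h (r k) u v \<partial>\<mu> (r k) \<partial>\<mu> (r k))"
      unfolding distr[of k, symmetric] by (intro nn_integral_distr_twice[symmetric] \<Omega>) measurable
    also have "\<dots> = (\<integral>\<^sup>+i. \<integral>\<^sup>+j. h (r k) (\<sigma> (r k) i) (\<sigma> (r k) j) \<partial>p (r k) \<partial>p (r k))"
      unfolding \<mu>_def by (intro nn_integral_distr_twice p) measurable
    also have "\<dots> \<le> of_nat (1 + 2 * C)"
      unfolding h_def p_def by (rule truncated_energy_le[OF bound])
    finally show ?thesis .
  qed
  have h_lim: "(\<lambda>k. h (r k) (Z k u) (Z k v)) \<longlonglongrightarrow> riesz_kernel s (\<Phi> (Y u)) (\<Phi> (Y v))"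
    if "u \<in> space \<Omega>" "v \<in> space \<Omega>" for u v
  proof -
    have cont: "isCont \<Phi> z" for z
      using \<Phi> by (simp add: continuous_on_eq_continuous_at)
    \<comment> \<open>The truncation level grows with the index, so the limit is the full kernel,
      including the value infinity on the diagonal.\<close>
    have "filterlim (\<lambda>k. Suc (r k)) sequentially sequentially"
      using filterlim_subseq[OF r] filterlim_Suc by (rule filterlim_compose[rotated])
    then have "(\<lambda>k. of_nat (Suc (r k)) :: ennreal) \<longlonglongrightarrow> \<top>"
      using of_nat_tendsto_top_ennreal by (rule filterlim_compose[rotated])
    moreover have "(\<lambda>k. riesz_kernel s (\<Phi> (Z k u)) (\<Phi> (Z k v))) \<longlonglongrightarrow> riesz_kernel s (\<Phi> (Y u)) (\<Phi> (Y v))"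
      by (intro tendsto_riesz_kernel isCont_tendsto_compose[OF cont] lim that assms)
    ultimately have "(\<lambda>k. h (r k) (Z k u) (Z k v)) \<longlonglongrightarrow> min \<top> (riesz_kernel s (\<Phi> (Y u)) (\<Phi> (Y v)))"
      unfolding h_def by (rule tendsto_min)
    then show ?thesis
      by simp
  qed
  have "(\<integral>\<^sup>+u. \<integral>\<^sup>+v. riesz_kernel s (\<Phi> (Y u)) (\<Phi> (Y v)) \<partial>\<Omega> \<partial>\<Omega>)
      = (\<integral>\<^sup>+u. \<integral>\<^sup>+v. liminf (\<lambda>k. h (r k) (Z k u) (Z k v)) \<partial>\<Omega> \<partial>\<Omega>)"
    using h_lim by (intro nn_integral_cong lim_imp_Liminf[symmetric]) auto
  also have "\<dots> \<le> (\<integral>\<^sup>+u. liminf (\<lambda>k. \<integral>\<^sup>+v. h (r k) (Z k u) (Z k v) \<partial>\<Omega>) \<partial>\<Omega>)"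
    by (intro nn_integral_mono nn_integral_liminf) measurable
  also have "\<dots> \<le> liminf (\<lambda>k. \<integral>\<^sup>+u. \<integral>\<^sup>+v. h (r k) (Z k u) (Z k v) \<partial>\<Omega> \<partial>\<Omega>)"
    by (intro nn_integral_liminf \<Omega>.borel_measurable_nn_integral) measurable
  also have "\<dots> \<le> limsup (\<lambda>k. \<integral>\<^sup>+u. \<integral>\<^sup>+v. h (r k) (Z k u) (Z k v) \<partial>\<Omega> \<partial>\<Omega>)"
    by (intro Liminf_le_Limsup) simp
  also have "\<dots> \<le> of_nat (1 + 2 * C)"
    using h_le by (intro Limsup_bounded always_eventually allI)
  also have "\<dots> < \<top>"
    by (rule of_nat_less_top)
  finally have fin: "(\<integral>\<^sup>+u. \<integral>\<^sup>+v. riesz_kernel s (\<Phi> (Y u)) (\<Phi> (Y v)) \<partial>\<Omega> \<partial>\<Omega>) < \<top>" .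
  \<comment> \<open>Only the law of \<open>Z k\<close> is known, and it is carried by the finite
    sample set. This later identifies \<open>Z k \<omega>\<close> as the parameter of actual points
    on the graphs.\<close>
  have AE: "AE \<omega> in \<Omega>. Z k \<omega> \<in> \<sigma> (r k) ` {..<Suc (r k)}" for k
  proof -
    have [measurable]: "\<sigma> (r k) ` {..<Suc (r k)} \<in> sets borel"
      by (intro borel_closed finite_imp_closed) simp
    have "AE i in p (r k). \<sigma> (r k) i \<in> \<sigma> (r k) ` {..<Suc (r k)}"
      unfolding p_def by (intro AE_pmfI) (auto simp: lessThan_empty_iff)
    then have "AE z in \<mu> (r k). z \<in> \<sigma> (r k) ` {..<Suc (r k)}"
      unfolding \<mu>_def by (subst AE_distr_iff) auto
    then show ?thesis
      unfolding distr[symmetric] by (subst (asm) AE_distr_iff) auto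
  qed
  show thesis
    by (rule that[OF \<Omega> Y lim AE fin])
qed

text \<open>The measure \<open>\<nu>\<close> conditioned on \<open>Q\<close> and pushed forward by
  \<open>\<phi>\<close> is an admissible competitor, since its support lies in the compact image of
  \<open>Q\<close>. Conditioning multiplies the energy at most by \<open>emeasure \<nu> Q\<close> to
  the power -2.\<close>

lemma riesz_capacity_pos_of_compact_image:
  fixes \<phi> :: "real \<Rightarrow> 'a::euclidean_space"
  assumes \<nu>: "sets \<nu> = sets borel" "finite_measure \<nu>" and \<phi>: "continuous_on UNIV \<phi>"
    and Q: "compact Q" "0 < emeasure \<nu> Q" "\<phi> ` Q \<subseteq> A"
    and energy: "(\<integral>\<^sup>+u. \<integral>\<^sup>+v. riesz_kernel s (\<phi> u) (\<phi> v) \<partial>\<nu> \<partial>\<nu>) < \<top>"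
  shows "0 < riesz_capacity s A"
proof -
  interpret finite_measure \<nu> by fact
  note [measurable_cong] = \<nu>(1)
  have Q_sets [measurable]: "Q \<in> sets \<nu>"
    using Q(1) \<nu>(1) by (simp add: borel_closed compact_imp_closed)
  have \<phi>_meas [measurable]: "\<phi> \<in> borel_measurable borel"
    using \<phi> by (rule borel_measurable_continuous_onI)
  define \<kappa> where "\<kappa> = uniform_measure \<nu> Q"
  define \<mu> where "\<mu> = distr \<kappa> borel \<phi>"
  have sets_\<kappa> [measurable_cong]: "sets \<kappa> = sets borel"
    by (simp add: \<kappa>_def \<nu>(1))
  interpret \<kappa>: prob_space \<kappa>
    unfolding \<kappa>_def using Q(2) by (intro prob_space_uniform_measure) auto
  interpret \<mu>: prob_space \<mu>
    unfolding \<mu>_def by (intro \<kappa>.prob_space_distr) measurable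
  have comp: "compact (\<phi> ` Q)"
    using Q(1) \<phi> by (meson compact_continuous_image continuous_on_subset subset_UNIV)
  have compl: "- \<phi> ` Q \<in> sets borel"
    by (intro borel_open open_Compl compact_imp_closed comp)
  have "emeasure \<mu> (- \<phi> ` Q) = 0"
  proof -
    have "emeasure \<mu> (- \<phi> ` Q) = emeasure \<kappa> (\<phi> -` (- \<phi> ` Q) \<inter> space \<kappa>)"
      unfolding \<mu>_def by (intro emeasure_distr compl) measurable
    also have "\<dots> = emeasure \<nu> (Q \<inter> (\<phi> -` (- \<phi> ` Q) \<inter> space \<kappa>)) / emeasure \<nu> Q"
    proof -
      have "\<phi> -` (- \<phi> ` Q) \<inter> space \<kappa> \<in> sets \<nu>"
        using measurable_sets[of \<phi> \<kappa> borel "- \<phi> ` Q"] compl sets_\<kappa> \<nu>(1) by simp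
      then show ?thesis
        unfolding \<kappa>_def by (intro emeasure_uniform_measure Q_sets) 
    qed
    also have "Q \<inter> (\<phi> -` (- \<phi> ` Q) \<inter> space \<kappa>) = {}"
      by auto
    finally show ?thesis by simp
  qed
  then have supp: "measure_support \<mu> \<subseteq> \<phi> ` Q"
    using comp by (intro measure_support_subset compact_imp_closed) (auto simp: \<mu>_def)
  have "closed (measure_support \<mu>)"
    by (rule closed_measure_support)
  then have "compact (measure_support \<mu>)"
    using comp supp by (metis compact_Int_closed inf.absorb_iff2)
  with supp Q(3) have mem: "\<mu> \<in> compact_prob_measures A"
    using \<mu>.prob_space_axioms by (auto simp: compact_prob_measures_def \<mu>_def)
  have \<kappa>_le: "(\<integral>\<^sup>+x. f x \<partial>\<kappa>) \<le> (\<integral>\<^sup>+x. f x \<partial>\<nu>) / emeasure \<nu> Q" if [measurable]: "f \<in> borel_measurable borel" for f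
    unfolding \<kappa>_def
    by (subst nn_integral_uniform_measure)
      (auto intro!: divide_right_mono_ennreal nn_integral_mono simp: indicator_def)
  have "riesz_energy s \<mu> = (\<integral>\<^sup>+u. \<integral>\<^sup>+v. riesz_kernel s (\<phi> u) (\<phi> v) \<partial>\<kappa> \<partial>\<kappa>)"
    unfolding riesz_energy_eq \<mu>_def by (intro nn_integral_distr_twice \<kappa>.prob_space_axioms) measurable
  also have "\<dots> \<le> (\<integral>\<^sup>+u. (\<integral>\<^sup>+v. riesz_kernel s (\<phi> u) (\<phi> v) \<partial>\<nu>) / emeasure \<nu> Q \<partial>\<kappa>)"
    by (intro nn_integral_mono \<kappa>_le) measurable
  also have "\<dots> \<le> (\<integral>\<^sup>+u. (\<integral>\<^sup>+v. riesz_kernel s (\<phi> u) (\<phi> v) \<partial>\<nu>) / emeasure \<nu> Q \<partial>\<nu>) / emeasure \<nu> Q"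
    by (intro \<kappa>_le) measurable
  also have "\<dots> = (\<integral>\<^sup>+u. \<integral>\<^sup>+v. riesz_kernel s (\<phi> u) (\<phi> v) \<partial>\<nu> \<partial>\<nu>) / emeasure \<nu> Q / emeasure \<nu> Q"
    by (subst nn_integral_divide) (auto, measurable)
  also have "\<dots> < \<top>"
    using energy Q(2) by (auto simp: less_top[symmetric] ennreal_divide_eq_top_iff)
  finally show ?thesis
    using mem unfolding riesz_capacity_pos_iff by blast
qed

text \<open>The paths jump, so the map from times to values is not continuous and does not commute
  with weak limits. Points of the graphs are therefore encoded by the parameter of a continuous
  curve. Keeping the time next to the value is what allows a limit to be recognised as a point of
  the graph or a left limit.\<close>

lemma riesz_capacity_pos_of_pairwise_bounded:
  fixes x :: "nat \<Rightarrow> real \<Rightarrow> 'a::euclidean_space"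
  assumes "0 < s" "0 \<le> a" and x: "\<And>j. j \<in> {1..N} \<Longrightarrow> cadlag (x j)"
    and bounded: "\<And>L. pairwise_bounded s C L (block_range N x a b)"
  shows "0 < riesz_capacity s (block_range N x a b)"
proof -
  have "\<exists>t. (\<forall>i<Suc L. \<forall>j\<in>{1..N}. t i j \<in> {a..b}) \<and>
      (\<Sum>k<Suc L. \<Sum>i<k. riesz_kernel s (\<Sum>j\<in>{1..N}. x j (t i j)) (\<Sum>j\<in>{1..N}. x j (t k j))) \<le> of_nat (C * (Suc L)\<^sup>2)" for L
  proof -
    from bounded[of "Suc L"] obtain y where y: "\<forall>i<Suc L. y i \<in> block_range N x a b"
      "(\<Sum>k<Suc L. \<Sum>i<k. riesz_kernel s (y i) (y k)) \<le> of_nat (C * (Suc L)\<^sup>2)"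
      unfolding pairwise_bounded_def by blast
    have "\<exists>t. i < Suc L \<longrightarrow> y i = (\<Sum>j\<in>{1..N}. x j (t j)) \<and> (\<forall>j\<in>{1..N}. t j \<in> {a..b})" for i
      using y(1) unfolding block_range_def by blast
    then obtain t where t: "\<And>i. i < Suc L \<Longrightarrow> y i = (\<Sum>j\<in>{1..N}. x j (t i j)) \<and> (\<forall>j\<in>{1..N}. t i j \<in> {a..b})"
      by metis
    have "(\<Sum>k<Suc L. \<Sum>i<k. riesz_kernel s (\<Sum>j\<in>{1..N}. x j (t i j)) (\<Sum>j\<in>{1..N}. x j (t k j)))
        = (\<Sum>k<Suc L. \<Sum>i<k. riesz_kernel s (y i) (y k))"
      using t by (intro sum.cong arg_cong2[where f = "riesz_kernel s"]) auto
    with y(2) t show ?thesis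
      by (intro exI[of _ t]) auto
  qed
  then have "\<exists>t. \<forall>L. (\<forall>i<Suc L. \<forall>j\<in>{1..N}. t L i j \<in> {a..b}) \<and>
      (\<Sum>k<Suc L. \<Sum>i<k. riesz_kernel s (\<Sum>j\<in>{1..N}. x j (t L i j)) (\<Sum>j\<in>{1..N}. x j (t L k j))) \<le> of_nat (C * (Suc L)\<^sup>2)"
    by (intro choice allI)
  then obtain t where t: "\<And>L i j. i < Suc L \<Longrightarrow> j \<in> {1..N} \<Longrightarrow> t L i j \<in> {a..b}"
    and t_energy: "\<And>L. (\<Sum>k<Suc L. \<Sum>i<k. riesz_kernel s (\<Sum>j\<in>{1..N}. x j (t L i j)) (\<Sum>j\<in>{1..N}. x j (t L k j)))
      \<le> of_nat (C * (Suc L)\<^sup>2)"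
    by blast

  have "bounded ((\<lambda>t. (t, x j t)) ` {a..b})" if j: "j \<in> {1..N}" for j
  proof -
    obtain R where R: "\<And>t. t \<in> {a..b} \<Longrightarrow> norm (x j t) \<le> R"
      using cadlag_bounded[OF x[OF j] \<open>0 \<le> a\<close>, of b] by blast
    have "norm (t, x j t) \<le> max \<bar>a\<bar> \<bar>b\<bar> + R" if "t \<in> {a..b}" for t
      using norm_Pair_le[of t "x j t"] R[OF that] that by auto
    then show ?thesis
      unfolding bounded_iff by blast
  qed
  then have "bounded (\<Union>j\<in>{1..N}. (\<lambda>t. (t, x j t)) ` {a..b})"
    by (intro bounded_UN) auto
  then obtain R where R: "0 < R" "\<And>j t. j \<in> {1..N} \<Longrightarrow> t \<in> {a..b} \<Longrightarrow> norm (t, x j t) < R"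
    unfolding bounded_pos_less by blast
  obtain G :: "real \<Rightarrow> nat \<Rightarrow> real \<times> 'a" where
    G: "\<And>j. continuous_on UNIV (\<lambda>\<sigma>. G \<sigma> j)" and
    G_surj: "\<And>z. (\<And>j. norm (z j) < R) \<Longrightarrow> \<exists>\<sigma>\<in>{0..1}. \<forall>j. G \<sigma> j = z j"
    using space_filling_curve[OF R(1)] by metis
  have "\<exists>\<sigma>\<in>{0..1}. i < Suc L \<longrightarrow> (\<forall>j\<in>{1..N}. G \<sigma> j = (t L i j, x j (t L i j)))" for L i
  proof (cases "i < Suc L")
    case True
    define z where "z j = (if j \<in> {1..N} then (t L i j, x j (t L i j)) else 0)" for j
    have "norm (z j) < R" for j
      using R t[OF True] by (simp add: z_def)
    then have "\<exists>\<sigma>\<in>{0..1}. \<forall>j. G \<sigma> j = z j"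
      by (rule G_surj)
    then obtain \<sigma> where "\<sigma> \<in> {0..1}" "\<forall>j. G \<sigma> j = z j" ..
    then show ?thesis
      by (intro bexI[of _ \<sigma>]) (simp_all add: z_def)
  qed (auto intro: bexI[of _ 0])
  then have "\<exists>\<sigma>. \<forall>L i. \<sigma> L i \<in> {0..1} \<and> (i < Suc L \<longrightarrow> (\<forall>j\<in>{1..N}. G (\<sigma> L i) j = (t L i j, x j (t L i j))))"
    unfolding Bex_def by (intro choice allI)
  then obtain \<sigma> where \<sigma>: "\<And>L i. \<sigma> L i \<in> {0..1}"
    "\<And>L i j. i < Suc L \<Longrightarrow> j \<in> {1..N} \<Longrightarrow> G (\<sigma> L i) j = (t L i j, x j (t L i j))"
    by blast
  define \<Phi> where "\<Phi> u = (\<Sum>j\<in>{1..N}. snd (G u j))" for u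
  have \<Phi>: "continuous_on UNIV \<Phi>"
    unfolding \<Phi>_def by (intro continuous_on_sum continuous_on_snd G)
  have \<Phi>_bound: "(\<Sum>k<Suc L. \<Sum>i<k. riesz_kernel s (\<Phi> (\<sigma> L i)) (\<Phi> (\<sigma> L k))) \<le> of_nat (C * (Suc L)\<^sup>2)" for L
  proof -
    have *: "\<Phi> (\<sigma> L i) = (\<Sum>j\<in>{1..N}. x j (t L i j))" if "i < Suc L" for i
      unfolding \<Phi>_def using \<sigma>(2)[OF that] by (intro sum.cong) auto
    have "(\<Sum>k<Suc L. \<Sum>i<k. riesz_kernel s (\<Phi> (\<sigma> L i)) (\<Phi> (\<sigma> L k)))
        = (\<Sum>k<Suc L. \<Sum>i<k. riesz_kernel s (\<Sum>j\<in>{1..N}. x j (t L i j)) (\<Sum>j\<in>{1..N}. x j (t L k j)))"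
      by (intro sum.cong arg_cong2[where f = "riesz_kernel s"] *) auto
    with t_energy[of L] show ?thesis by simp
  qed
  obtain \<Omega> :: "real measure" and Z :: "nat \<Rightarrow> real \<Rightarrow> real" and Y :: "real \<Rightarrow> real" and r :: "nat \<Rightarrow> nat"
    where \<Omega>: "prob_space \<Omega>" and Y [measurable]: "Y \<in> borel_measurable \<Omega>"
      and lim: "\<And>\<omega>. \<omega> \<in> space \<Omega> \<Longrightarrow> (\<lambda>k. Z k \<omega>) \<longlonglongrightarrow> Y \<omega>"
      and Z: "\<And>k. AE \<omega> in \<Omega>. Z k \<omega> \<in> \<sigma> (r k) ` {..<Suc (r k)}"
      and energy: "(\<integral>\<^sup>+u. \<integral>\<^sup>+v. riesz_kernel s (\<Phi> (Y u)) (\<Phi> (Y v)) \<partial>\<Omega> \<partial>\<Omega>) < \<top>"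
    by (rule finite_energy_limit[OF \<open>0 < s\<close> \<Phi> \<sigma>(1) \<Phi>_bound]) (rule that)
  interpret \<Omega>: prob_space \<Omega> by fact

  \<comment> \<open>\<open>Y\<close> lies in the closure of the graphs of the paths, which adds only the left limits. Hence
    \<open>\<Phi> (Y \<omega>)\<close> differs from a point of the range by a sum of jumps, which takes countably many values;
    on a compact set where this sum is constant, the energy does not see the difference.\<close>
  define J where "J j = insert 0 {x j t - l | t l. (x j \<longlongrightarrow> l) (at_left t)}" for j
  have J: "countable (J j)" for j
    unfolding J_def using countable_cadlag_jumps[of "x j"] by simp
  \<comment> \<open>The parameters with times in \<open>{a..b}\<close> whose encoded values miss the
    graphs by exactly the vector \<open>c\<close>.\<close>
  define B where "B c = {u. \<forall>j\<in>{1..N}. fst (G u j) \<in> {a..b} \<and> x j (max 0 (fst (G u j))) - snd (G u j) = c j}" for c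
  have [measurable]: "(\<lambda>u. fst (G u j)) \<in> borel_measurable borel" "(\<lambda>u. snd (G u j)) \<in> borel_measurable borel" for j
    using G by (auto intro!: borel_measurable_continuous_onI continuous_on_fst continuous_on_snd)
  have B [measurable]: "B c \<in> sets borel" for c
  proof -
    have "{u \<in> space borel. fst (G u j) \<in> {a..b} \<and> x j (max 0 (fst (G u j))) - snd (G u j) = c j} \<in> sets borel"
      if "j \<in> {1..N}" for j
    proof -
      have [measurable]: "(\<lambda>u. x j (max 0 (fst (G u j)))) \<in> borel_measurable borel"
        by (rule measurable_compose[OF _ borel_measurable_cadlag[OF x[OF that]]]) measurable
      show ?thesis
        by measurable
    qed
    then have "{u \<in> space borel. \<forall>j\<in>{1..N}. fst (G u j) \<in> {a..b} \<and> x j (max 0 (fst (G u j))) - snd (G u j) = c j} \<in> sets borel"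
      by (rule sets.sets_Collect_finite_All) simp_all
    then show ?thesis
      by (simp only: B_def space_borel UNIV_I simp_thms)
  qed
  have "AE \<omega> in \<Omega>. \<forall>k. Z k \<omega> \<in> \<sigma> (r k) ` {..<Suc (r k)}"
    using Z by (simp add: AE_all_countable)
  then have cover: "AE \<omega> in \<Omega>. Y \<omega> \<in> (\<Union>c\<in>PiE {1..N} J. B c)"
    using AE_space
  proof eventually_elim
    case (elim \<omega>)
    have *: "fst (G (Y \<omega>) j) \<in> {a..b} \<and> x j (max 0 (fst (G (Y \<omega>) j))) - snd (G (Y \<omega>) j) \<in> J j"
      if j: "j \<in> {1..N}" for j
    proof -
      define \<tau> where "\<tau> k = fst (G (Z k \<omega>) j)" for k
      have "\<exists>i<Suc (r k). Z k \<omega> = \<sigma> (r k) i" for k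
        using elim(1) by blast
      then have \<tau>: "\<tau> k \<in> {a..b}" "snd (G (Z k \<omega>) j) = x j (\<tau> k)" for k
        using \<sigma>(2)[OF _ j] t[OF _ j] unfolding \<tau>_def by (metis fst_conv snd_conv)+
      have "isCont (\<lambda>u. G u j) (Y \<omega>)"
        using G[of j] by (simp add: continuous_on_eq_continuous_at)
      from isCont_tendsto_compose[OF this lim[OF elim(2)]]
      have G_lim: "(\<lambda>k. G (Z k \<omega>) j) \<longlonglongrightarrow> G (Y \<omega>) j" .
      have \<tau>_lim: "\<tau> \<longlonglongrightarrow> fst (G (Y \<omega>) j)"
        unfolding \<tau>_def by (rule tendsto_fst[OF G_lim])
      have x_lim: "(\<lambda>k. x j (\<tau> k)) \<longlonglongrightarrow> snd (G (Y \<omega>) j)"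
        using tendsto_snd[OF G_lim] unfolding \<tau>(2) .
      have mem: "fst (G (Y \<omega>) j) \<in> {a..b}"
        using closed_sequentially[OF closed_atLeastAtMost \<tau>(1) \<tau>_lim] .
      have "0 \<le> \<tau> k" for k
        using \<tau>(1)[of k] \<open>0 \<le> a\<close> by simp
      from cadlag_graph_limit[OF x[OF j] this \<tau>_lim x_lim]
      have "x j (fst (G (Y \<omega>) j)) - snd (G (Y \<omega>) j) \<in> J j"
        unfolding J_def by auto
      moreover have "max 0 (fst (G (Y \<omega>) j)) = fst (G (Y \<omega>) j)"
        using mem \<open>0 \<le> a\<close> by simp
      ultimately show ?thesis
        using mem by simp
    qed
    then show ?case
      by (intro UN_I[of "\<lambda>j\<in>{1..N}. x j (max 0 (fst (G (Y \<omega>) j))) - snd (G (Y \<omega>) j)"])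
        (auto simp: B_def PiE_iff)
  qed
  define \<nu> where "\<nu> = distr \<Omega> borel Y"
  interpret \<nu>: prob_space \<nu>
    unfolding \<nu>_def by (intro \<Omega>.prob_space_distr Y)
  have sets_\<nu>: "sets \<nu> = sets borel"
    by (simp add: \<nu>_def)
  have "\<exists>c\<in>PiE {1..N} J. 0 < emeasure \<nu> (B c)"
  proof (rule ccontr)
    assume "\<not> ?thesis"
    then have "\<And>c. c \<in> PiE {1..N} J \<Longrightarrow> B c \<in> null_sets \<nu>"
      by (auto simp: null_sets_def sets_\<nu> zero_less_iff_neq_zero)
    then have "(\<Union>c\<in>PiE {1..N} J. B c) \<in> null_sets \<nu>"
      using J by (intro null_sets_UN' countable_PiE) auto
    then have "AE u in \<nu>. u \<notin> (\<Union>c\<in>PiE {1..N} J. B c)"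
      by (rule AE_not_in)
    then have "AE \<omega> in \<Omega>. Y \<omega> \<notin> (\<Union>c\<in>PiE {1..N} J. B c)"
      unfolding \<nu>_def by (rule AE_distrD[OF Y])
    with cover have "AE \<omega> in \<Omega>. False"
      by eventually_elim blast
    then show False by simp
  qed
  then obtain c where c: "0 < emeasure \<nu> (B c)" by blast
  \<comment> \<open>The competitor needs a compact support inside the range itself, so the Borel set
    \<open>B c\<close> is replaced by a compact part of positive mass.\<close>
  have "emeasure \<nu> (B c) = (SUP K\<in>{K. K \<subseteq> B c \<and> compact K}. emeasure \<nu> K)"
    by (rule inner_regular[OF sets_\<nu> _ B]) simp
  with c have "0 < (SUP K\<in>{K. K \<subseteq> B c \<and> compact K}. emeasure \<nu> K)"
    by simp
  then obtain Q where Q: "Q \<subseteq> B c" "compact Q" "0 < emeasure \<nu> Q"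
    unfolding less_SUP_iff by auto
  define \<phi> where "\<phi> u = \<Phi> u + (\<Sum>j\<in>{1..N}. c j)" for u
  have \<phi>: "continuous_on UNIV \<phi>"
    unfolding \<phi>_def by (intro continuous_intros \<Phi>)
  have \<Phi>_meas [measurable]: "\<Phi> \<in> borel_measurable borel"
    using \<Phi> by (rule borel_measurable_continuous_onI)
  have image: "\<phi> ` Q \<subseteq> block_range N x a b"
  proof (rule image_subsetI)
    fix u assume "u \<in> Q"
    with Q(1) have u: "fst (G u j) \<in> {a..b}" "x j (max 0 (fst (G u j))) - snd (G u j) = c j"
      if "j \<in> {1..N}" for j
      using that by (auto simp: B_def)
    have "\<phi> u = (\<Sum>j\<in>{1..N}. x j (fst (G u j)))"
      unfolding \<phi>_def \<Phi>_def sum.distrib[symmetric]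
    proof (intro sum.cong refl)
      fix j assume j: "j \<in> {1..N}"
      have "max 0 (fst (G u j)) = fst (G u j)"
        using u(1)[OF j] \<open>0 \<le> a\<close> by simp
      with u(2)[OF j] show "snd (G u j) + c j = x j (fst (G u j))"
        by (simp add: algebra_simps)
    qed
    with u(1) show "\<phi> u \<in> block_range N x a b"
      unfolding block_range_def mem_Collect_eq by (intro exI[of _ "\<lambda>j. fst (G u j)"]) simp
  qed
  have "(\<integral>\<^sup>+u. \<integral>\<^sup>+v. riesz_kernel s (\<phi> u) (\<phi> v) \<partial>\<nu> \<partial>\<nu>) = (\<integral>\<^sup>+u. \<integral>\<^sup>+v. riesz_kernel s (\<Phi> u) (\<Phi> v) \<partial>\<nu> \<partial>\<nu>)"
    by (simp add: \<phi>_def)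
  also have "\<dots> = (\<integral>\<^sup>+u. \<integral>\<^sup>+v. riesz_kernel s (\<Phi> (Y u)) (\<Phi> (Y v)) \<partial>\<Omega> \<partial>\<Omega>)"
    unfolding \<nu>_def by (intro nn_integral_distr_twice \<Omega>) measurable
  finally have "(\<integral>\<^sup>+u. \<integral>\<^sup>+v. riesz_kernel s (\<phi> u) (\<phi> v) \<partial>\<nu> \<partial>\<nu>) < \<top>"
    using energy by simp
  from riesz_capacity_pos_of_compact_image[OF sets_\<nu> \<nu>.finite_measure_axioms \<phi> Q(2,3) image this]
  show ?thesis .
qed

section \<open>Monotonicity, images, translations and increasing unions\<close>

lemma riesz_capacity_pos_mono:
  assumes "A \<subseteq> B" "0 < riesz_capacity s A"
  shows "0 < riesz_capacity s B"
  using assms unfolding riesz_capacity_pos_iff compact_prob_measures_def by blast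

text \<open>For finite \<open>T\<close> the points are chosen from a finite set of possibilities, so
  the condition becomes a finite union of inequalities between kernel sums; measurability is read
  off from this form.\<close>

lemma pairwise_bounded_image_iff:
  "pairwise_bounded s C L (f ` T) \<longleftrightarrow>
    (\<exists>\<tau>\<in>PiE {..<L} (\<lambda>_. T). (\<Sum>j<L. \<Sum>i<j. riesz_kernel s (f (\<tau> i)) (f (\<tau> j))) \<le> of_nat (C * L\<^sup>2))"
proof
  assume "pairwise_bounded s C L (f ` T)"
  then obtain y where y: "\<forall>i<L. y i \<in> f ` T"
    "(\<Sum>j<L. \<Sum>i<j. riesz_kernel s (y i) (y j)) \<le> of_nat (C * L\<^sup>2)"
    unfolding pairwise_bounded_def by blast
  have "\<forall>i\<in>{..<L}. \<exists>t. t \<in> T \<and> y i = f t"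
    using y(1) by auto
  from bchoice[OF this] obtain \<tau> where \<tau>: "\<And>i. i < L \<Longrightarrow> \<tau> i \<in> T" "\<And>i. i < L \<Longrightarrow> y i = f (\<tau> i)"
    by auto
  have "(\<Sum>j<L. \<Sum>i<j. riesz_kernel s (f (restrict \<tau> {..<L} i)) (f (restrict \<tau> {..<L} j)))
      = (\<Sum>j<L. \<Sum>i<j. riesz_kernel s (y i) (y j))"
    using \<tau>(2) by (intro sum.cong) auto
  with y(2) \<tau>(1) show "\<exists>\<tau>\<in>PiE {..<L} (\<lambda>_. T).
      (\<Sum>j<L. \<Sum>i<j. riesz_kernel s (f (\<tau> i)) (f (\<tau> j))) \<le> of_nat (C * L\<^sup>2)"
    by (intro bexI[of _ "restrict \<tau> {..<L}"]) auto
next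
  assume "\<exists>\<tau>\<in>PiE {..<L} (\<lambda>_. T). (\<Sum>j<L. \<Sum>i<j. riesz_kernel s (f (\<tau> i)) (f (\<tau> j))) \<le> of_nat (C * L\<^sup>2)"
  then obtain \<tau> where "\<tau> \<in> PiE {..<L} (\<lambda>_. T)"
    "(\<Sum>j<L. \<Sum>i<j. riesz_kernel s (f (\<tau> i)) (f (\<tau> j))) \<le> of_nat (C * L\<^sup>2)" ..
  then show "pairwise_bounded s C L (f ` T)"
    unfolding pairwise_bounded_def by (intro exI[of _ "\<lambda>i. f (\<tau> i)"]) auto
qed

lemma pairwise_bounded_translate:
  "pairwise_bounded s C L ((\<lambda>z. f z + c) ` T) \<longleftrightarrow> pairwise_bounded s C L (f ` T)"
  by (simp add: pairwise_bounded_image_iff)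

lemma pairwise_bounded_UN_incseq:
  assumes B: "incseq B" and "pairwise_bounded s C L (\<Union>m. B m)"
  shows "\<exists>m. pairwise_bounded s C L (B m)"
proof -
  from assms(2) obtain y where y: "\<forall>i<L. y i \<in> (\<Union>m. B m)"
    "(\<Sum>j<L. \<Sum>i<j. riesz_kernel s (y i) (y j)) \<le> of_nat (C * L\<^sup>2)"
    unfolding pairwise_bounded_def by blast
  have "\<forall>i\<in>{..<L}. \<exists>m. y i \<in> B m"
    using y(1) by auto
  from bchoice[OF this] obtain m where m: "\<And>i. i < L \<Longrightarrow> y i \<in> B (m i)"
    by auto
  have "y i \<in> B (Max (m ` {..<L}))" if "i < L" for i
    using m[OF that] incseqD[OF B Max_ge[of "m ` {..<L}" "m i"]] that by auto
  with y(2) show ?thesis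
    unfolding pairwise_bounded_def by blast
qed

text \<open>Asking for all \<open>L \<le> K\<close> at once makes the condition decreasing in
  \<open>K\<close>, as monotone limits require; one \<open>m\<close> suffices because only finitely
  many \<open>L\<close> are involved.\<close>

lemma pairwise_bounded_UN_incseq_uniform:
  assumes B: "incseq B" and bound: "\<And>L. pairwise_bounded s C L (\<Union>m. B m)"
  shows "\<exists>m. \<forall>L\<le>K. pairwise_bounded s C L (B m)"
proof -
  have "\<exists>m. \<forall>L. pairwise_bounded s C L (B (m L))"
    using pairwise_bounded_UN_incseq[OF B bound] by (intro choice allI)
  then obtain m where m: "\<And>L. pairwise_bounded s C L (B (m L))"
    by blast
  have "pairwise_bounded s C L (B (Max (m ` {..K})))" if "L \<le> K" for L
    using that by (intro pairwise_bounded_mono[OF m incseqD[OF B] order_refl] Max_ge) auto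
  then show ?thesis by blast
qed

section \<open>The zero-one law\<close>

text \<open>The only consequence of \<open>A 0, A 1, \<dots>\<close> being independent of equal probability that is needed;
  in this form it is preserved by monotone limits.\<close>

definition iid_misses :: "'w measure \<Rightarrow> (nat \<Rightarrow> 'w set) \<Rightarrow> bool" where
  "iid_misses M A \<longleftrightarrow> (\<forall>i. A i \<in> sets M) \<and>
     (\<forall>K. measure M (space M - (\<Union>i<K. A i)) = (1 - measure M (A 0)) ^ K)"

lemma (in prob_space) iid_misses_UN:
  assumes A: "\<And>n. iid_misses M (A n)" and inc: "\<And>i. incseq (\<lambda>n. A n i)"
  shows "iid_misses M (\<lambda>i. \<Union>n. A n i)"
  unfolding iid_misses_def
proof (intro conjI allI)
  have sets: "A n i \<in> events" for n i
    using A by (simp add: iid_misses_def)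
  then show "(\<Union>n. A n i) \<in> events" for i
    by auto
  fix K
  have "(\<lambda>n. prob (space M - (\<Union>i<K. A n i))) \<longlonglongrightarrow> prob (\<Inter>n. space M - (\<Union>i<K. A n i))"
  proof (intro finite_Lim_measure_decseq decseq_SucI)
    show "range (\<lambda>n. space M - (\<Union>i<K. A n i)) \<subseteq> events"
      using sets by auto
    show "space M - (\<Union>i<K. A (Suc n) i) \<subseteq> space M - (\<Union>i<K. A n i)" for n
      using incseq_SucD[OF inc] by blast
  qed
  moreover have "(\<Inter>n. space M - (\<Union>i<K. A n i)) = space M - (\<Union>i<K. \<Union>n. A n i)"
    by auto
  moreover have "prob (space M - (\<Union>i<K. A n i)) = (1 - prob (A n 0)) ^ K" for n
    using A by (simp add: iid_misses_def)
  ultimately have "(\<lambda>n. (1 - prob (A n 0)) ^ K) \<longlonglongrightarrow> prob (space M - (\<Union>i<K. \<Union>n. A n i))"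
    by simp
  moreover have "(\<lambda>n. (1 - prob (A n 0)) ^ K) \<longlonglongrightarrow> (1 - prob (\<Union>n. A n 0)) ^ K"
    using sets inc by (intro tendsto_intros finite_Lim_measure_incseq) auto
  ultimately show "prob (space M - (\<Union>i<K. \<Union>n. A n i)) = (1 - prob (\<Union>n. A n 0)) ^ K"
    by (rule LIMSEQ_unique)
qed

text \<open>Missing each of \<open>K\<close> decreasing intersections already happens at one common
  stage, since finitely many indices have a maximum. So the complements increase to their limit and
  continuity from below applies.\<close>

lemma (in prob_space) iid_misses_INT:
  assumes A: "\<And>n. iid_misses M (A n)" and dec: "\<And>i. decseq (\<lambda>n. A n i)"
  shows "iid_misses M (\<lambda>i. \<Inter>n. A n i)"
  unfolding iid_misses_def
proof (intro conjI allI)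
  have sets: "A n i \<in> events" for n i
    using A by (simp add: iid_misses_def)
  then show "(\<Inter>n. A n i) \<in> events" for i
    by auto
  fix K
  have "(\<lambda>n. prob (space M - (\<Union>i<K. A n i))) \<longlonglongrightarrow> prob (\<Union>n. space M - (\<Union>i<K. A n i))"
  proof (intro finite_Lim_measure_incseq incseq_SucI)
    show "range (\<lambda>n. space M - (\<Union>i<K. A n i)) \<subseteq> events"
      using sets by auto
    show "space M - (\<Union>i<K. A n i) \<subseteq> space M - (\<Union>i<K. A (Suc n) i)" for n
      using decseq_SucD[OF dec] by blast
  qed
  moreover have "(\<Union>n. space M - (\<Union>i<K. A n i)) = space M - (\<Union>i<K. \<Inter>n. A n i)"
  proof (intro equalityI subsetI)
    fix \<omega> assume \<omega>: "\<omega> \<in> space M - (\<Union>i<K. \<Inter>n. A n i)"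
    then have "\<forall>i\<in>{..<K}. \<exists>n. \<omega> \<notin> A n i"
      by auto
    from bchoice[OF this] obtain n where n: "\<And>i. i < K \<Longrightarrow> \<omega> \<notin> A (n i) i"
      by auto
    have "\<omega> \<notin> A (Max (n ` {..<K})) i" if "i < K" for i
      using n[OF that] decseqD[OF dec[of i] Max_ge[of "n ` {..<K}" "n i"]] that by auto
    with \<omega> show "\<omega> \<in> (\<Union>n. space M - (\<Union>i<K. A n i))"
      by auto
  qed auto
  moreover have "prob (space M - (\<Union>i<K. A n i)) = (1 - prob (A n 0)) ^ K" for n
    using A by (simp add: iid_misses_def)
  ultimately have "(\<lambda>n. (1 - prob (A n 0)) ^ K) \<longlonglongrightarrow> prob (space M - (\<Union>i<K. \<Inter>n. A n i))"
    by simp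
  moreover have "(\<lambda>n. (1 - prob (A n 0)) ^ K) \<longlonglongrightarrow> (1 - prob (\<Inter>n. A n 0)) ^ K"
    using sets dec by (intro tendsto_intros finite_Lim_measure_decseq) auto
  ultimately show "prob (space M - (\<Union>i<K. \<Inter>n. A n i)) = (1 - prob (\<Inter>n. A n 0)) ^ K"
    by (rule LIMSEQ_unique)
qed

text \<open>The complement of \<open>E\<close> misses every \<open>A i\<close>, so its probability
  is at most \<open>(1 - prob (A 0)) ^ K\<close> for all \<open>K\<close>, and these powers tend to
  0.\<close>

lemma (in prob_space) iid_misses_imp_prob_eq_1:
  assumes A: "iid_misses M A" and pos: "0 < prob (A 0)" and E: "E \<in> events" "(\<Union>i. A i) \<subseteq> E"
  shows "prob E = 1"
proof -
  have "prob (space M - E) \<le> (1 - prob (A 0)) ^ K" for K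
  proof -
    have "prob (space M - E) \<le> prob (space M - (\<Union>i<K. A i))"
      using E A by (intro finite_measure_mono) (auto simp: iid_misses_def)
    also have "\<dots> = (1 - prob (A 0)) ^ K"
      using A by (simp add: iid_misses_def)
    finally show ?thesis .
  qed
  moreover have "(\<lambda>K. (1 - prob (A 0)) ^ K) \<longlonglongrightarrow> 0"
    using pos prob_le_1[of "A 0"] by (intro LIMSEQ_power_zero) simp
  ultimately have "prob (space M - E) \<le> 0"
    by (intro LIMSEQ_le_const) auto
  then show ?thesis
    using prob_compl[OF E(1)] measure_nonneg[of M "space M - E"] prob_le_1[of E] by linarith
qed

text \<open>Two kinds of independence are merged into one family indexed by pairs. Across
  \<open>j\<close> it is that of the whole processes, applied to the events \<open>B j\<close> in
  path space; for each \<open>j\<close>, the independence of increments splits the resulting factor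
  further.\<close>

lemma indep_vars_additive_levy_increments:
  fixes X :: "nat \<Rightarrow> real \<Rightarrow> 'w \<Rightarrow> 'a::euclidean_space"
  assumes X: "additive_levy_process M N X" and t: "0 \<le> t 0" "mono t" and "0 < n"
  shows "prob_space.indep_vars M (\<lambda>_. borel) (\<lambda>(j, p) \<omega>. X j (t (Suc p)) \<omega> - X j (t p) \<omega>) ({1..N} \<times> {..<n::nat})"
proof -
  have N: "1 \<le> N" and levy: "\<And>j. j \<in> {1..N} \<Longrightarrow> levy_process M (X j)" and ind: "independent_processes M N X"
    using X by (auto simp: additive_levy_process_def)
  interpret prob_space M
    using levy[of 1] N by (auto simp: levy_process_def)
  have t_nonneg: "0 \<le> t p" for p
    using t monoD[OF t(2), of 0 p] by simp
  have meas: "X j u \<in> borel_measurable M" if "j \<in> {1..N}" "0 \<le> u" for j u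
    using levy[OF that(1)] that(2) by (simp add: levy_process_def)
  define \<xi> where "\<xi> = (\<lambda>(j, p) \<omega>. X j (t (Suc p)) \<omega> - X j (t p) \<omega>)"
  have \<xi>_meas: "random_variable borel (\<xi> z)" if "z \<in> {1..N} \<times> {..<n}" for z
    using that meas t_nonneg by (auto simp: \<xi>_def)
  have "indep_vars (\<lambda>_. borel) \<xi> ({1..N} \<times> {..<n})"
  proof (subst indep_vars_finite[where E = "\<lambda>_. sets borel"])
    show "\<forall>A\<in>({1..N} \<times> {..<n}) \<rightarrow> sets borel.
        prob (\<Inter>z\<in>{1..N} \<times> {..<n}. \<xi> z -` A z \<inter> space M) = (\<Prod>z\<in>{1..N} \<times> {..<n}. prob (\<xi> z -` A z \<inter> space M))"
    proof
      fix A :: "nat \<times> nat \<Rightarrow> 'a set" assume A: "A \<in> ({1..N} \<times> {..<n}) \<rightarrow> sets borel"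
      let ?W = "\<lambda>j \<omega>. \<lambda>u\<in>{0..}. X j u \<omega>"
      let ?P = "PiM {0::real..} (\<lambda>_. borel :: 'a measure)"
      define B where "B j = {w \<in> space ?P. \<forall>p\<in>{..<n}. w (t (Suc p)) - w (t p) \<in> A (j, p)}" for j
      have B: "B j \<in> sets ?P" if "j \<in> {1..N}" for j
        unfolding B_def
      proof (rule sets.sets_Collect_finite_All)
        fix p assume "p \<in> {..<n}"
        with A that have "A (j, p) \<in> sets borel" by auto
        moreover have "(\<lambda>w. w (t (Suc p)) - w (t p)) \<in> borel_measurable ?P"
          using t_nonneg by (intro borel_measurable_diff measurable_component_singleton) auto
        ultimately show "{w \<in> space ?P. w (t (Suc p)) - w (t p) \<in> A (j, p)} \<in> sets ?P"
          by (intro predE pred_sets2)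
      qed simp
      have W_B: "?W j -` B j \<inter> space M = (\<Inter>p\<in>{..<n}. \<xi> (j, p) -` A (j, p) \<inter> space M)" for j
        using t_nonneg \<open>0 < n\<close> by (auto simp: B_def \<xi>_def space_PiM)
      have "(\<Inter>z\<in>{1..N} \<times> {..<n}. \<xi> z -` A z \<inter> space M) = (\<Inter>j\<in>{1..N}. ?W j -` B j \<inter> space M)"
        unfolding W_B using N by auto
      also have "prob \<dots> = (\<Prod>j\<in>{1..N}. prob (?W j -` B j \<inter> space M))"
        using ind N B unfolding independent_processes_def by (intro indep_varsD_finite) auto
      also have "\<dots> = (\<Prod>j\<in>{1..N}. \<Prod>p\<in>{..<n}. prob (\<xi> (j, p) -` A (j, p) \<inter> space M))"
      proof (rule prod.cong[OF refl])
        fix j assume j: "j \<in> {1..N}"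
        have "indep_vars (\<lambda>_. borel) (\<lambda>p \<omega>. X j (t (Suc p)) \<omega> - X j (t p) \<omega>) {..<n}"
          using levy[OF j] t by (auto simp: levy_process_def independent_increments_def)
        then have "indep_vars (\<lambda>_. borel) (\<lambda>p. \<xi> (j, p)) {..<n}"
          by (simp add: \<xi>_def)
        then show "prob (?W j -` B j \<inter> space M) = (\<Prod>p\<in>{..<n}. prob (\<xi> (j, p) -` A (j, p) \<inter> space M))"
          unfolding W_B using A j \<open>0 < n\<close> by (intro indep_varsD_finite) auto
      qed
      also have "\<dots> = (\<Prod>z\<in>{1..N} \<times> {..<n}. prob (\<xi> z -` A z \<inter> space M))"
        by (simp add: prod.cartesian_product case_prod_unfold)
      finally show "prob (\<Inter>z\<in>{1..N} \<times> {..<n}. \<xi> z -` A z \<inter> space M)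
        = (\<Prod>z\<in>{1..N} \<times> {..<n}. prob (\<xi> z -` A z \<inter> space M))" .
    qed
    show "{1..N} \<times> {..<n} \<noteq> {}"
      using N \<open>0 < n\<close> by auto
    show "sets (borel :: 'a measure) = sigma_sets (space borel) (sets borel)" "Int_stable (sets (borel :: 'a measure))"
      "space (borel :: 'a measure) \<in> sets borel" "sets (borel :: 'a measure) \<subseteq> Pow (space borel)"
      using sets.sigma_sets_eq[of "borel :: 'a measure"] by (auto simp: Int_stable_def)
  qed (use \<xi>_meas in auto)
  then show ?thesis
    unfolding \<xi>_def .
qed

text \<open>By translation invariance the starting value of a block is irrelevant, so the event of
  block \<open>i\<close> is the preimage of one fixed set \<open>S\<close> under the vector
  \<open>V i\<close> of increments in that block. These vectors are independent and have the same
  law.\<close>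

lemma iid_misses_dyadic_blocks:
  fixes X :: "nat \<Rightarrow> real \<Rightarrow> 'w \<Rightarrow> 'a::euclidean_space"
  assumes X: "additive_levy_process M N X" and "0 < n"
  shows "iid_misses M (\<lambda>i. {\<omega> \<in> space M. \<forall>k\<le>L. pairwise_bounded s C k
    (dyadic_range N (\<lambda>j t. X j t \<omega>) (real (i * n)) n m)})"
proof -
  have N: "1 \<le> N" and levy: "\<And>j. j \<in> {1..N} \<Longrightarrow> levy_process M (X j)"
    using X by (auto simp: additive_levy_process_def)
  interpret prob_space M
    using levy[of 1] N by (auto simp: levy_process_def)
  \<comment> \<open>The number of grid steps per block in each coordinate: block \<open>i\<close>
    starts at step \<open>i * P\<close>, because \<open>h (i * P)\<close> is the time
    \<open>i * n\<close>.\<close>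
  define P where "P = n * 2 ^ m"
  define h where "h p = real p / 2 ^ m" for p :: nat
  define I where "I = {1..N} \<times> {..<P}"
  define T where "T = PiE {1..N} (\<lambda>_. {..P})"
  define \<xi> where "\<xi> = (\<lambda>(j, p) \<omega>. X j (h (Suc p)) \<omega> - X j (h p) \<omega>)"
  define V where "V i \<omega> = (\<lambda>z\<in>I. \<xi> (fst z, i * P + snd z) \<omega>)" for i \<omega>
  \<comment> \<open>The position relative to the start of the block, recovered from its increments
    by telescoping.\<close>
  define pos where "pos v l = (\<Sum>j\<in>{1..N}. \<Sum>q<l j. v (j, q))" for v :: "nat \<times> nat \<Rightarrow> 'a" and l
  let ?Pi = "PiM I (\<lambda>_. borel :: 'a measure)"
  define S where "S = {v \<in> space ?Pi. \<forall>k\<in>{..L}. \<exists>\<tau>\<in>PiE {..<k} (\<lambda>_. T).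
    (\<Sum>j<k. \<Sum>i<j. riesz_kernel s (pos v (\<tau> i)) (pos v (\<tau> j))) \<le> of_nat (C * k\<^sup>2)}"
  have P: "0 < P" and I: "I \<noteq> {}"
    using \<open>0 < n\<close> N by (simp_all add: P_def I_def Sigma_empty_iff lessThan_empty_iff)
  have T: "finite T"
    unfolding T_def by (intro finite_PiE) auto
  have h: "0 \<le> h p" "h (p + q) = h p + h q" "mono h" for p q
    by (auto simp: h_def mono_def add_divide_distrib divide_right_mono)

  have range: "dyadic_range N (\<lambda>j t. X j t \<omega>) (real (i * n)) n m
      = (\<lambda>l. pos (V i \<omega>) l + (\<Sum>j\<in>{1..N}. X j (h (i * P)) \<omega>)) ` T" for i \<omega>
  proof -
    have "dyadic_range N (\<lambda>j t. X j t \<omega>) (real (i * n)) n m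
        = (\<lambda>l. \<Sum>j\<in>{1..N}. X j (h (i * P + l j)) \<omega>) ` T"
    proof -
      have time: "real (i * n) + real q / 2 ^ m = h (i * P + q)" for q
        by (simp add: h_def P_def field_simps)
      show ?thesis
        unfolding dyadic_range_def time
      proof safe
        fix l assume "\<forall>j\<in>{1..N}. l j \<le> n * 2 ^ m"
        then show "(\<Sum>j\<in>{1..N}. X j (h (i * P + l j)) \<omega>) \<in> (\<lambda>l. \<Sum>j\<in>{1..N}. X j (h (i * P + l j)) \<omega>) ` T"
          by (intro image_eqI[of _ _ "restrict l {1..N}"] sum.cong) (auto simp: T_def P_def)
      next
        fix l assume "l \<in> T"
        then have "\<forall>j\<in>{1..N}. l j \<le> n * 2 ^ m"
          by (auto simp: T_def P_def)
        then show "\<exists>l'. (\<Sum>j\<in>{1..N}. X j (h (i * P + l j)) \<omega>) = (\<Sum>j\<in>{1..N}. X j (h (i * P + l' j)) \<omega>)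
            \<and> (\<forall>j\<in>{1..N}. l' j \<le> n * 2 ^ m)"
          by blast
      qed
    qed
    also have "\<dots> = (\<lambda>l. pos (V i \<omega>) l + (\<Sum>j\<in>{1..N}. X j (h (i * P)) \<omega>)) ` T"
    proof (rule image_cong[OF refl])
      fix l assume l: "l \<in> T"
      have "(\<Sum>q<l j. V i \<omega> (j, q)) + X j (h (i * P)) \<omega> = X j (h (i * P + l j)) \<omega>" if j: "j \<in> {1..N}" for j
      proof -
        have "l j \<le> P"
          using l j by (auto simp: T_def)
        then have "(\<Sum>q<l j. V i \<omega> (j, q)) = (\<Sum>q<l j. X j (h (i * P + Suc q)) \<omega> - X j (h (i * P + q)) \<omega>)"
          using j by (intro sum.cong) (auto simp: V_def I_def \<xi>_def)
        also have "\<dots> = X j (h (i * P + l j)) \<omega> - X j (h (i * P)) \<omega>"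
          by (subst sum_lessThan_telescope[of "\<lambda>q. X j (h (i * P + q)) \<omega>"]) simp
        finally show ?thesis by simp
      qed
      then show "(\<Sum>j\<in>{1..N}. X j (h (i * P + l j)) \<omega>) = pos (V i \<omega>) l + (\<Sum>j\<in>{1..N}. X j (h (i * P)) \<omega>)"
        unfolding pos_def sum.distrib[symmetric] by (intro sum.cong) auto
    qed
    finally show ?thesis .
  qed
  have V_space: "V i \<omega> \<in> space ?Pi" for i \<omega>
    by (auto simp: V_def space_PiM)
  have event: "{\<omega> \<in> space M. \<forall>k\<le>L. pairwise_bounded s C k (dyadic_range N (\<lambda>j t. X j t \<omega>) (real (i * n)) n m)}
      = V i -` S \<inter> space M" for i
    using V_space unfolding range pairwise_bounded_translate pairwise_bounded_image_iff S_def by auto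

  have S: "S \<in> sets ?Pi"
    unfolding S_def
  proof (intro sets.sets_Collect_finite_All sets.sets_Collect_finite_Ex)
    fix k \<tau> assume "k \<in> {..L}" and \<tau>: "\<tau> \<in> PiE {..<k} (\<lambda>_. T)"
    have pos: "(\<lambda>v. pos v (\<tau> i)) \<in> borel_measurable ?Pi" if "i < k" for i
      unfolding pos_def
    proof (intro borel_measurable_sum measurable_component_singleton)
      fix j q assume "j \<in> {1..N}" "q \<in> {..<\<tau> i j}"
      moreover from this have "\<tau> i j \<le> P"
        using \<tau> that by (auto simp: T_def PiE_iff)
      ultimately show "(j, q) \<in> I"
        by (auto simp: I_def)
    qed
    have "(\<lambda>v. \<Sum>j<k. \<Sum>i<j. riesz_kernel s (pos v (\<tau> i)) (pos v (\<tau> j))) \<in> borel_measurable ?Pi"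
      by (intro borel_measurable_sum measurable_riesz_kernel pos) auto
    then show "{v \<in> space ?Pi. (\<Sum>j<k. \<Sum>i<j. riesz_kernel s (pos v (\<tau> i)) (pos v (\<tau> j))) \<le> of_nat (C * k\<^sup>2)} \<in> sets ?Pi"
      by measurable
  qed (auto intro: finite_PiE T)

  \<comment> \<open>\<open>D\<close> ignores the second component: by stationarity every increment
    of a process has the law of its first grid step. Hence the product law of \<open>V i\<close>
    does not involve \<open>i\<close>.\<close>
  define D where "D = (\<lambda>z :: nat \<times> nat. distr M borel (\<lambda>\<omega>. X (fst z) (h 1) \<omega> - X (fst z) 0 \<omega>))"
  have V_distr: "distr M ?Pi (V i) = PiM I (\<lambda>z. D z)" for i
  proof -
    have mono: "mono (\<lambda>q. h (i * P + q))"
      using h(3) by (auto simp: mono_def)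
    have *: "indep_vars (\<lambda>_. borel) (\<lambda>(j, q) \<omega>. X j (h (i * P + Suc q)) \<omega> - X j (h (i * P + q)) \<omega>) I"
      using indep_vars_additive_levy_increments[OF X _ mono P] h(1) unfolding I_def by simp
    define \<eta> where "\<eta> = (\<lambda>z. \<xi> (fst z, i * P + snd z))"
    have ind: "indep_vars (\<lambda>_. borel) \<eta> I"
      using * by (simp add: \<eta>_def \<xi>_def case_prod_unfold)
    have rv: "\<eta> z \<in> borel_measurable M" if "z \<in> I" for z
      using ind that unfolding indep_vars_def by blast
    have "distr M ?Pi (\<lambda>\<omega>. \<lambda>z\<in>I. \<eta> z \<omega>) = PiM I (\<lambda>z. distr M borel (\<eta> z))"
      using ind indep_vars_iff_distr_eq_PiM'[where X = \<eta> and M' = "\<lambda>_. borel", OF I rv] by simp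
    also have "\<dots> = PiM I D"
    proof (rule PiM_cong[OF refl])
      fix z assume "z \<in> I"
      then have j: "fst z \<in> {1..N}"
        by (auto simp: I_def)
      have "distr M borel (\<lambda>\<omega>. X (fst z) (h (i * P + snd z) + h 1) \<omega> - X (fst z) (h (i * P + snd z)) \<omega>) = D z"
        using levy[OF j] h(1) unfolding D_def levy_process_def stationary_increments_def by blast
      moreover have "h (i * P + snd z) + h 1 = h (Suc (i * P + snd z))"
        unfolding h(2)[symmetric] by simp
      ultimately show "distr M borel (\<eta> z) = D z"
        by (simp add: \<eta>_def \<xi>_def)
    qed
    finally show ?thesis
      unfolding V_def \<eta>_def .
  qed

  have V_indep: "indep_vars (\<lambda>_. ?Pi) V {..<K}" if "0 < K" for K
  proof -
    \<comment> \<open>The index rectangle of block \<open>i\<close>. Diagonal blocks use disjoint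
      ranges of steps in every coordinate; blocks sharing a time interval in one coordinate would
      share increments of that process.\<close>
    define J where "J i = {1..N} \<times> {i * P..<i * P + P}" for i
    have block: "i * P + P \<le> K * P" if "i < K" for i
      using mult_le_mono1[of "Suc i" K P] that by simp
    have "indep_vars (\<lambda>_. borel) (\<lambda>(j, p) \<omega>. X j (h (Suc p)) \<omega> - X j (h p) \<omega>) ({1..N} \<times> {..<K * P})"
      using indep_vars_additive_levy_increments[OF X, of h "K * P"] h(1,3) P that by simp
    then have "indep_vars (\<lambda>_. borel) \<xi> ({1..N} \<times> {..<K * P})"
      unfolding \<xi>_def .
    then have "indep_vars (\<lambda>i. PiM (J i) (\<lambda>_. borel)) (\<lambda>i \<omega>. restrict (\<lambda>z. \<xi> z \<omega>) (J i)) {..<K}"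
    proof (rule indep_vars_restrict)
      show "J i \<subseteq> {1..N} \<times> {..<K * P}" if "i \<in> {..<K}" for i
        using block[of i] that by (auto simp: J_def)
      show "disjoint_family_on J {..<K}"
        unfolding disjoint_family_on_def
      proof (intro ballI impI)
        fix i i' :: nat assume "i \<noteq> i'"
        have "i = p div P" if "i * P \<le> p" "p < i * P + P" for i p
          using that P by (intro div_nat_eqI[symmetric]) (auto simp: mult.commute)
        with \<open>i \<noteq> i'\<close> show "J i \<inter> J i' = {}"
          by (auto simp: J_def) blast
      qed
    qed
    then have "indep_vars (\<lambda>_. ?Pi) (\<lambda>i \<omega>. (\<lambda>w. \<lambda>z\<in>I. w (fst z, i * P + snd z)) (restrict (\<lambda>z. \<xi> z \<omega>) (J i))) {..<K}"
    proof (rule indep_vars_compose2)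
      fix i assume "i \<in> {..<K}"
      show "(\<lambda>w. \<lambda>z\<in>I. w (fst z, i * P + snd z)) \<in> measurable (PiM (J i) (\<lambda>_. borel)) ?Pi"
        by (intro measurable_restrict measurable_component_singleton) (auto simp: J_def I_def)
    qed
    also have "(\<lambda>i \<omega>. (\<lambda>w. \<lambda>z\<in>I. w (fst z, i * P + snd z)) (restrict (\<lambda>z. \<xi> z \<omega>) (J i))) = V"
      by (auto simp: V_def J_def I_def fun_eq_iff)
    finally show ?thesis .
  qed
  have V_meas: "V i \<in> measurable M ?Pi" for i
    using V_indep[of "Suc i"] by (auto simp: indep_vars_def)
  have compl: "prob (V i -` (space ?Pi - S) \<inter> space M) = 1 - prob (V 0 -` S \<inter> space M)" for i
  proof -
    have "prob (V i -` (space ?Pi - S) \<inter> space M) = measure (distr M ?Pi (V i)) (space ?Pi - S)"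
      using S V_meas by (subst measure_distr) auto
    also have "\<dots> = measure (distr M ?Pi (V 0)) (space ?Pi - S)"
      unfolding V_distr ..
    also have "\<dots> = prob (V 0 -` (space ?Pi - S) \<inter> space M)"
      using S V_meas by (subst measure_distr) auto
    also have "V 0 -` (space ?Pi - S) \<inter> space M = space M - (V 0 -` S \<inter> space M)"
      using V_space by auto
    also have "prob \<dots> = 1 - prob (V 0 -` S \<inter> space M)"
      using S V_meas by (intro prob_compl measurable_sets)
    finally show ?thesis .
  qed
  have "prob (space M - (\<Union>i<K. V i -` S \<inter> space M)) = (1 - prob (V 0 -` S \<inter> space M)) ^ K" for K
  proof (cases "K = 0")
    case False
    have "space M - (\<Union>i<K. V i -` S \<inter> space M) = (\<Inter>i\<in>{..<K}. V i -` (space ?Pi - S) \<inter> space M)"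
      using False V_space by auto
    also have "prob \<dots> = (\<Prod>i\<in>{..<K}. prob (V i -` (space ?Pi - S) \<inter> space M))"
      using False S V_indep[of K] by (intro indep_varsD_finite) auto
    also have "\<dots> = (1 - prob (V 0 -` S \<inter> space M)) ^ K"
      by (simp add: compl)
    finally show ?thesis .
  qed (simp add: prob_space)
  then show ?thesis
    unfolding event iid_misses_def using S V_meas by (auto intro: measurable_sets)
qed

theorem proposition10p2:
  fixes M :: "'w measure"
    and X :: "nat \<Rightarrow> real \<Rightarrow> 'w \<Rightarrow> 'a::euclidean_space"
    and N :: nat
    and \<beta> :: real
  assumes "additive_levy_process M N X"
    and "0 < \<beta>" and "\<beta> < real DIM('a)"
  shows "{\<omega> \<in> space M. 0 < riesz_capacity \<beta> ((\<lambda>t. additive_field N X t \<omega>) ` time_orthant N)} \<in> sets M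
    \<and> (measure M {\<omega> \<in> space M. 0 < riesz_capacity \<beta> ((\<lambda>t. additive_field N X t \<omega>) ` time_orthant N)} = 0
     \<or> measure M {\<omega> \<in> space M. 0 < riesz_capacity \<beta> ((\<lambda>t. additive_field N X t \<omega>) ` time_orthant N)} = 1)"
proof -
  have N: "1 \<le> N" and levy: "\<And>j. j \<in> {1..N} \<Longrightarrow> levy_process M (X j)"
    using assms(1) by (auto simp: additive_levy_process_def)
  interpret prob_space M
    using levy[of 1] N by (auto simp: levy_process_def)
  have cadlag: "cadlag (\<lambda>t. X j t \<omega>)" if "\<omega> \<in> space M" "j \<in> {1..N}" for \<omega> j
    using levy[OF that(2)] that(1) by (simp add: levy_process_def)
  define A where "A \<omega> = (\<lambda>t. additive_field N X t \<omega>) ` time_orthant N" for \<omega>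
  define x where "x \<omega> = (\<lambda>j t. X j t \<omega>)" for \<omega>
  define E where "E = {\<omega> \<in> space M. 0 < riesz_capacity \<beta> (A \<omega>)}"
  \<comment> \<open>With \<open>m\<close> fixed this involves finitely many increments only;
    \<open>Suc n\<close> keeps the blocks nondegenerate.\<close>
  define H where "H n C L m i = {\<omega> \<in> space M. \<forall>k\<le>L. pairwise_bounded \<beta> C k
    (dyadic_range N (x \<omega>) (real (i * Suc n)) (Suc n) m)}" for n C L m i
  \<comment> \<open>In this order all three limits are monotone: increasing in \<open>m\<close>,
    decreasing in \<open>L\<close>, increasing in \<open>C\<close>. So \<open>iid_misses\<close>
    passes through each of them.\<close>
  define F where "F n i = (\<Union>C. \<Inter>L. \<Union>m. H n C L m i)" for n i

  have A_eq: "A \<omega> = (\<Union>n. block_range N (x \<omega>) 0 (real (Suc n)))" for \<omega>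
  proof (intro equalityI subsetI)
    fix z assume "z \<in> A \<omega>"
    then obtain t where t: "z = (\<Sum>j\<in>{1..N}. X j (t j) \<omega>)" "\<And>j. j \<in> {1..N} \<Longrightarrow> 0 \<le> t j"
      by (auto simp: A_def time_orthant_def additive_field_def PiE_iff)
    obtain n where n: "(\<Sum>j\<in>{1..N}. t j) \<le> real n"
      using real_arch_simple by blast
    have "t j \<le> real (Suc n)" if "j \<in> {1..N}" for j
      using member_le_sum[of j "{1..N}" t] t(2) that n by fastforce
    with t show "z \<in> (\<Union>n. block_range N (x \<omega>) 0 (real (Suc n)))"
      unfolding block_range_def x_def by (intro UN_I[of n] CollectI exI[of _ t]) auto
  next
    fix z assume "z \<in> (\<Union>n. block_range N (x \<omega>) 0 (real (Suc n)))"
    then obtain n t where t: "z = (\<Sum>j\<in>{1..N}. X j (t j) \<omega>)" "\<forall>j\<in>{1..N}. t j \<in> {0..real (Suc n)}"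
      unfolding block_range_def x_def by blast
    then show "z \<in> A \<omega>"
      unfolding A_def
      by (intro image_eqI[of _ _ "restrict t {1..N}"]) (auto simp: additive_field_def time_orthant_def)
  qed

  have F_sub: "F n i \<subseteq> E" for n i
  proof
    fix \<omega> assume "\<omega> \<in> F n i"
    then obtain C where \<omega>: "\<omega> \<in> space M" and
      C: "\<And>L. \<exists>m. \<forall>k\<le>L. pairwise_bounded \<beta> C k (dyadic_range N (x \<omega>) (real (i * Suc n)) (Suc n) m)"
      by (auto simp: F_def H_def)
    let ?a = "real (i * Suc n)" and ?b = "real (i * Suc n) + real (Suc n)"
    have "pairwise_bounded \<beta> C L (block_range N (x \<omega>) ?a ?b)" for L
      using C[of L] pairwise_bounded_mono[OF _ dyadic_range_subset order_refl] by blast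
    then have "0 < riesz_capacity \<beta> (block_range N (x \<omega>) ?a ?b)"
      using cadlag[OF \<omega>] by (intro riesz_capacity_pos_of_pairwise_bounded assms) (auto simp: x_def)
    moreover have "block_range N (x \<omega>) ?a ?b \<subseteq> A \<omega>"
    proof -
      have b: "?b = real (Suc (i * Suc n + n))"
        by simp
      have "block_range N (x \<omega>) ?a ?b \<subseteq> block_range N (x \<omega>) 0 ?b"
        by (intro block_range_mono) auto
      then show ?thesis
        unfolding A_eq b by blast
    qed
    ultimately show "\<omega> \<in> E"
      using \<omega> riesz_capacity_pos_mono by (auto simp: E_def)
  qed

  \<comment> \<open>Since equality holds on all of \<open>space M\<close>, and not just almost
    surely, \<open>E\<close> is an event although \<open>M\<close> is not assumed complete.\<close>
  have E_eq: "E = (\<Union>n. F n 0)"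
  proof (intro equalityI subsetI)
    fix \<omega> assume "\<omega> \<in> E"
    then have \<omega>: "\<omega> \<in> space M" and pos: "0 < riesz_capacity \<beta> (\<Union>n. block_range N (x \<omega>) 0 (real (Suc n)))"
      by (auto simp: E_def A_eq)
    have "incseq (\<lambda>n. block_range N (x \<omega>) 0 (real (Suc n)))"
      by (intro incseq_SucI block_range_mono) auto
    with pos obtain n C where nC: "\<And>L. pairwise_bounded \<beta> C L (closure (block_range N (x \<omega>) 0 (real (Suc n))))"
      by (rule pairwise_bounded_of_riesz_capacity_pos) blast
    let ?D = "dyadic_range N (x \<omega>) 0 (Suc n)"
    have "block_range N (x \<omega>) 0 (0 + real (Suc n)) \<subseteq> closure (\<Union>m. ?D m)"
      using cadlag[OF \<omega>] by (intro block_range_subset_closure) (auto simp: x_def)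
    then have sub: "closure (block_range N (x \<omega>) 0 (real (Suc n))) \<subseteq> closure (\<Union>m. ?D m)"
      by (simp add: closure_minimal)
    \<comment> \<open>The added 1 pays for replacing points of the closed image by values at dyadic
      times.\<close>
    have "pairwise_bounded \<beta> (C + 1) L (\<Union>m. ?D m)" for L
      by (rule pairwise_bounded_dense[OF \<open>0 < \<beta>\<close> nC sub])
    moreover have "incseq ?D"
      by (intro incseq_SucI dyadic_range_mono) simp
    ultimately have "\<exists>m. \<forall>k\<le>L. pairwise_bounded \<beta> (C + 1) k (?D m)" for L
      by (intro pairwise_bounded_UN_incseq_uniform)
    with \<omega> have "\<omega> \<in> F n 0"
      unfolding F_def H_def by (intro UN_I[of "C + 1"]) auto
    then show "\<omega> \<in> (\<Union>n. F n 0)"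
      by blast
  qed (use F_sub in blast)

  have H_mono: "H n C L m i \<subseteq> H n C' L m' i" if "C \<le> C'" "m \<le> m'" for n C C' L m m' i
    unfolding H_def using pairwise_bounded_mono[OF _ dyadic_range_mono[OF that(2)] that(1)] by blast
  have F: "iid_misses M (F n)" for n
  proof -
    have "iid_misses M (\<lambda>i. \<Union>C. \<Inter>L. \<Union>m. H n C L m i)"
    proof (intro iid_misses_UN iid_misses_INT)
      show "iid_misses M (H n C L m)" for C L m
        using iid_misses_dyadic_blocks[OF assms(1), of "Suc n" L \<beta> C m] unfolding H_def x_def by simp
      show "incseq (\<lambda>m. H n C L m i)" for C L i
        by (intro incseq_SucI H_mono) simp_all
      show "decseq (\<lambda>L. \<Union>m. H n C L m i)" for C i
        unfolding H_def by (intro decseq_SucI UN_mono) auto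
      show "incseq (\<lambda>C. \<Inter>L. \<Union>m. H n C L m i)" for i
        by (intro incseq_SucI INF_mono' UN_mono order_refl H_mono) simp_all
    qed
    then show ?thesis
      unfolding F_def .
  qed
  have E_sets: "E \<in> events"
    unfolding E_eq using F by (auto simp: iid_misses_def)
  moreover have "prob E = 0 \<or> prob E = 1"
  proof (cases "\<exists>n. 0 < prob (F n 0)")
    case True
    then obtain n where "0 < prob (F n 0)" ..
    then have "prob E = 1"
      using F_sub by (intro iid_misses_imp_prob_eq_1[OF F[of n] _ E_sets]) auto
    then show ?thesis ..
  next
    case False
    then have "F n 0 \<in> null_sets M" for n
      using F[of n] measure_nonneg[of M "F n 0"] by (auto simp: null_sets_def iid_misses_def emeasure_eq_measure not_less intro: antisym)
    then have "E \<in> null_sets M"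
      unfolding E_eq by auto
    then show ?thesis
      by (simp add: measure_eq_0_null_sets)
  qed
  ultimately show ?thesis
    unfolding E_def A_def by blast
qed

end
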